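(* Let $\mathcal{S}\subseteq \mathbb{R}_{\geq 0}$ be a countable universal spectrum and let $\boldsymbol{U}_{\mathcal{S}}$ be the countable homogeneous universal metric space with spectrum $\mathcal{S}$. Then the distinguishing number satisfies $D(\boldsymbol{U}_{\mathcal{S}})=2$ or $D(\boldsymbol{U}_{\mathcal{S}})=\omega$, and the following hold. (1) If $\mathcal{S}$ has a positive limit (not necessarily in $\mathcal{S}$), then $D(\boldsymbol{U}_{\mathcal{S}})=2$. (2) If $\mathcal{S}$ has no positive limit but has $0$ as a limit, then $D(\boldsymbol{U}_{\mathcal{S}})=2$ if and only if $\mathcal{S}$ contains arbitrarily large elements of arbitrarily small distance, i.e. for every real $N$ and every $\varepsilon>0$ there exist $a<b$ in $\mathcal{S}$ with $a\geq N$ and $b-a<\varepsilon$. (3) If $\mathcal{S}$ does not have a limit, then $D(\boldsymbol{U}_{\mathcal{S}})=2$ if and only if $\mathcal{S}$ contains two positive elements $a<b$ with $b-a\leq \min\{s\in\mathcal{S}: s>0\}$.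
   Context: The spectrum of a metric space is the set of distances between its points (including $0$). For $\mathcal{S}\subseteq\mathbb{R}_{\geq 0}$, let $\mathfrak{A}(\mathcal{S})$ be the class of finite metric spaces whose spectrum is a subset of $\mathcal{S}$. $\mathcal{S}$ satisfies the 4-values condition if, whenever $\boldsymbol{A}$ on points $\{x,y,z\}$ and $\boldsymbol{B}$ on points $\{x,y,w\}$ are in $\mathfrak{A}(\mathcal{S})$ ($x,y,z,w$ distinct) with $d_{\boldsymbol{A}}(x,y)=d_{\boldsymbol{B}}(x,y)$, there is a metric space in $\mathfrak{A}(\mathcal{S})$ on $\{x,y,z,w\}$ extending both. A countable set $\mathcal{S}\subseteq\mathbb{R}_{\geq 0}$ is a universal spectrum if $0\in\mathcal{S}$, $\mathcal{S}$ contains at least one positive number, and $\mathcal{S}$ satisfies the 4-values condition. For a universal spectrum $\mathcal{S}$ it is known (Fraïssé theory) that $\mathfrak{A}(\mathcal{S})$ has the amalgamation property, and $\boldsymbol{U}_{\mathcal{S}}$ denotes its Fraïssé limit: the (unique up to isometry) countable metric space with spectrum $\mathcal{S}$ that is homogeneous (every isometry between finite subspaces extends to an automorphism, i.e. a bijective self-isometry, of the whole space) and universal (it embeds isometrically every member of $\mathfrak{A}(\mathcal{S})$). A limit of $\mathcal{S}$ is an accumulation point of $\mathcal{S}$ in $\mathbb{R}$ (not necessarily belonging to $\mathcal{S}$). The distinguishing number $D(\boldsymbol{M})$ of a structure $\boldsymbol{M}$ is the least cardinal $k$ such that the underlying set can be partitioned into $k$ cells so that only the identity automorphism of $\boldsymbol{M}$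 fixes every cell setwise. *)

theory Defs
  imports "HOL-Analysis.Analysis"
begin

unbundle cardinal_syntax

subsection \<open>Finite metric spaces over a set of distances\<close>

definition spectrum :: "'a set \<Rightarrow> ('a \<Rightarrow> 'a \<Rightarrow> real) \<Rightarrow> real set" where
  "spectrum M d = {d x y | x y. x \<in> M \<and> y \<in> M}"

definition finite_space_over :: "real set \<Rightarrow> 'a set \<Rightarrow> ('a \<Rightarrow> 'a \<Rightarrow> real) \<Rightarrow> bool" where
  "finite_space_over S M d \<longleftrightarrow> finite M \<and> Metric_space M d \<and> spectrum M d \<subseteq> S"

definition agree_on :: "'a set \<Rightarrow> ('a \<Rightarrow> 'a \<Rightarrow> real) \<Rightarrow> ('a \<Rightarrow> 'a \<Rightarrow> real) \<Rightarrow> bool" where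
  "agree_on A d e \<longleftrightarrow> (\<forall>u\<in>A. \<forall>v\<in>A. d u v = e u v)"

text \<open>The nature of the points is irrelevant; since a definition cannot quantify over types,
  finite metric spaces are represented on natural numbers, here and in
  \<open>universal_space\<close> below.\<close>

definition four_values :: "real set \<Rightarrow> bool" where
  "four_values S \<longleftrightarrow>
    (\<forall>(x::nat) y z w dA dB.
      distinct [x, y, z, w] \<and>
      finite_space_over S {x, y, z} dA \<and> finite_space_over S {x, y, w} dB \<and> dA x y = dB x y
      \<longrightarrow> (\<exists>d. finite_space_over S {x, y, z, w} d \<and>
               agree_on {x, y, z} d dA \<and> agree_on {x, y, w} d dB))"

definition universal_spectrum :: "real set \<Rightarrow> bool" where
  "universal_spectrum S \<longleftrightarrow>
    S \<subseteq> {0..} \<and> countable S \<and> 0 \<in> S \<and> (\<exists>s\<in>S. 0 < s) \<and> four_values S"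


subsection \<open>The homogeneous universal metric space\<close>

definition preserves_dist ::
    "'a set \<Rightarrow> ('a \<Rightarrow> 'a \<Rightarrow> real) \<Rightarrow> ('b \<Rightarrow> 'b \<Rightarrow> real) \<Rightarrow> ('a \<Rightarrow> 'b) \<Rightarrow> bool" where
  "preserves_dist A d e f \<longleftrightarrow> (\<forall>x\<in>A. \<forall>y\<in>A. e (f x) (f y) = d x y)"

definition automorphism :: "'a set \<Rightarrow> ('a \<Rightarrow> 'a \<Rightarrow> real) \<Rightarrow> ('a \<Rightarrow> 'a) \<Rightarrow> bool" where
  "automorphism M d g \<longleftrightarrow> bij_betw g M M \<and> preserves_dist M d d g"

definition homogeneous_space :: "'a set \<Rightarrow> ('a \<Rightarrow> 'a \<Rightarrow> real) \<Rightarrow> bool" where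
  "homogeneous_space M d \<longleftrightarrow>
    (\<forall>A B f. finite A \<and> A \<subseteq> M \<and> B \<subseteq> M \<and> bij_betw f A B \<and> preserves_dist A d d f
      \<longrightarrow> (\<exists>g. automorphism M d g \<and> (\<forall>x\<in>A. g x = f x)))"

definition universal_space :: "real set \<Rightarrow> 'a set \<Rightarrow> ('a \<Rightarrow> 'a \<Rightarrow> real) \<Rightarrow> bool" where
  "universal_space S M d \<longleftrightarrow>
    (\<forall>(N :: nat set) e. finite_space_over S N e
      \<longrightarrow> (\<exists>f. f ` N \<subseteq> M \<and> preserves_dist N e d f))"

definition urysohn_space :: "real set \<Rightarrow> 'a set \<Rightarrow> ('a \<Rightarrow> 'a \<Rightarrow> real) \<Rightarrow> bool" where
  "urysohn_space S M d \<longleftrightarrow>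
    Metric_space M d \<and> countable M \<and> spectrum M d = S \<and>
    homogeneous_space M d \<and> universal_space S M d"


subsection \<open>The distinguishing number\<close>

definition distinguishing_partition ::
    "'a set \<Rightarrow> ('a \<Rightarrow> 'a \<Rightarrow> real) \<Rightarrow> 'a set set \<Rightarrow> bool" where
  "distinguishing_partition M d P \<longleftrightarrow>
    partition_on M P \<and>
    (\<forall>g. automorphism M d g \<and> (\<forall>C\<in>P. g ` C = C) \<longrightarrow> (\<forall>x\<in>M. g x = x))"

text \<open>A cardinal in the sense of the library's cardinals-as-wellorders, hence to be compared
  with other cardinals by \<open>=o\<close> only.\<close>

definition distinguishing_number :: "'a set \<Rightarrow> ('a \<Rightarrow> 'a \<Rightarrow> real) \<Rightarrow> 'a set rel" where
  "distinguishing_number M d =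
    (SOME r. \<exists>P. distinguishing_partition M d P \<and> r = |P| \<and>
                 (\<forall>Q. distinguishing_partition M d Q \<longrightarrow> |P| \<le>o |Q| ))"

text \<open>The choice above is never void: the partition into singletons is distinguishing, and
  cardinals are well-ordered.\<close>

lemma distinguishing_number_least:
  "\<exists>P. distinguishing_partition M d P \<and> distinguishing_number M d = |P| \<and>
       (\<forall>Q. distinguishing_partition M d Q \<longrightarrow> |P| \<le>o |Q| )"
proof -
  let ?R = "{|P| | P. distinguishing_partition M d P}"
  have "distinguishing_partition M d ((\<lambda>x. {x}) ` M)"
    unfolding distinguishing_partition_def by (auto simp: partition_on_def disjoint_def)
  then have ne: "?R \<noteq> {}" by blast
  have "\<forall>r\<in>?R. Card_order r" using card_of_Card_order by blast
  then obtain r where "r \<in> ?R" "\<forall>r'\<in>?R. r \<le>o r'"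
    using exists_minim_Card_order[OF ne] by blast
  then have "\<exists>r P. distinguishing_partition M d P \<and> r = |P| \<and>
      (\<forall>Q. distinguishing_partition M d Q \<longrightarrow> |P| \<le>o |Q| )" by blast
  from someI_ex[OF this] show ?thesis
    unfolding distinguishing_number_def by metis
qed

end

theory Submission
  imports Defs
begin

text \<open>By homogeneity and universality, every positive \<open>S\<close>-valued Katetov function on a finite
  subset of the space is realized by a point, and by the 4-values condition such functions extend to
  larger finite sets, with the new values kept above a prescribed bound.

  Colour \<open>2 ^ j\<close> points at distance \<open>r j\<close> from the \<open>j\<close>-th point and at larger distance
  from the earlier ones, where the \<open>r j\<close> do not decrease: then no automorphism preserving the
  colouring can exchange two points. This is possible when \<open>S\<close> has close pairs \<open>r j < e j\<close>, hence
  whenever \<open>S\<close> accumulates from the left at a positive number, and in the cases of value 2 of (2)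
  and (3). If \<open>S\<close> accumulates at \<open>l > 0\<close> from the right, one chooses instead a set whose mutual
  distances exceed \<open>l\<close>, in which decreasing labels near \<open>l\<close> mark single pairs of points.

  In the remaining cases every finite colouring has a nontrivial automorphism: a transposition of
  two points at minimal distance, or one obtained by back-and-forth in a ball in which every colour
  that occurs is dense. There all positive distances are isolated in \<open>S\<close>, so that the set of
  realizations of a Katetov function is open.\<close>

section \<open>The 4-values condition and Katetov functions\<close>

text \<open>\<open>t\<close> is the distance between the two apexes when triangles with sides
  \<open>p\<close>, \<open>a\<close>, \<open>b\<close> and \<open>p\<close>, \<open>a'\<close>,
  \<open>b'\<close> are glued along \<open>p\<close>. It is positive because the four points of the
  amalgam are distinct.\<close>

lemma four_valuesD:
  assumes "four_values S" "0 \<in> S"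
    and "p \<in> S" "a \<in> S" "b \<in> S" "a' \<in> S" "b' \<in> S"
    and "0 < p" "0 < a" "0 < b" "0 < a'" "0 < b'"
    and "p \<le> a + b" "a \<le> p + b" "b \<le> p + a"
    and "p \<le> a' + b'" "a' \<le> p + b'" "b' \<le> p + a'"
  shows "\<exists>t\<in>S. 0 < t \<and> \<bar>a - a'\<bar> \<le> t \<and> t \<le> a + a' \<and> \<bar>b - b'\<bar> \<le> t \<and> t \<le> b + b'"
proof -
  \<comment> \<open>The triangle with base \<open>p\<close> on the points 0 and 1 and with apex
    \<open>k\<close>, which is at distance \<open>s\<close> from 0 and \<open>t\<close> from
    1.\<close>
  define D :: "nat \<Rightarrow> real \<Rightarrow> real \<Rightarrow> nat \<Rightarrow> nat \<Rightarrow> real" where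
    "D k s t = (\<lambda>i j. if i = j then 0 else if i \<noteq> k \<and> j \<noteq> k then p
       else if i = 0 \<or> j = 0 then s else t)" for k s t
  have D: "finite_space_over S {0, 1, k} (D k s t)"
    if "k > 1" "s \<in> S" "t \<in> S" "0 < s" "0 < t" "p \<le> s + t" "s \<le> p + t" "t \<le> p + s" for k s t
    unfolding finite_space_over_def
  proof (intro conjI)
    show "Metric_space {0, 1, k} (D k s t)"
      by standard (use that \<open>0 < p\<close> in \<open>auto simp: D_def\<close>)
    show "spectrum {0, 1, k} (D k s t) \<subseteq> S"
      using that assms(2,3) by (auto simp: D_def spectrum_def)
  qed simp
  have "\<exists>d. finite_space_over S {0, 1, 2, 3} d \<and>
         agree_on {0, 1, 2} d (D 2 a b) \<and> agree_on {0, 1, 3} d (D 3 a' b')"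
    using assms(1) D[of 2 a b] D[of 3 a' b'] assms unfolding four_values_def
    by (auto simp: D_def)
  then obtain d where d: "finite_space_over S {0, 1, 2, 3} d"
    "agree_on {0, 1, 2} d (D 2 a b)" "agree_on {0, 1, 3} d (D 3 a' b')" by blast
  interpret Metric_space "{0, 1, 2, 3::nat}" d
    using d(1) by (simp add: finite_space_over_def)
  have v: "d 0 2 = a" "d 1 2 = b" "d 0 3 = a'" "d 1 3 = b'"
    using d(2,3) by (auto simp: agree_on_def D_def)
  have "d 2 3 \<in> S"
    using d(1) by (auto simp: finite_space_over_def spectrum_def)
  moreover have "0 < d 2 3" by (simp add: mdist_pos_less)
  moreover have "\<bar>d 0 2 - d 0 3\<bar> \<le> d 2 3" "d 2 3 \<le> d 0 2 + d 0 3"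
    using triangle[of 0 2 3] triangle[of 0 3 2] triangle[of 2 0 3] by (auto simp: commute)
  moreover have "\<bar>d 1 2 - d 1 3\<bar> \<le> d 2 3" "d 2 3 \<le> d 1 2 + d 1 3"
    using triangle[of 1 2 3] triangle[of 1 3 2] triangle[of 2 1 3] by (auto simp: commute)
  ultimately show ?thesis
    unfolding v by blast
qed

lemma finite_positive_lower_bound:
  fixes A :: "real set"
  assumes "finite A" "\<And>a. a \<in> A \<Longrightarrow> 0 < a"
  obtains \<delta> where "0 < \<delta>" "\<And>a. a \<in> A \<Longrightarrow> \<delta> \<le> a"
proof
  \<comment> \<open>The element 1 covers the case of empty \<open>A\<close>.\<close>
  show "0 < Min (insert 1 A)"
    using assms by (subst Min_gr_iff) auto
  show "Min (insert 1 A) \<le> a" if "a \<in> A" for a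
    using assms(1) that by (intro Min_le) auto
qed

locale urysohn = Metric_space M d for M :: "'a set" and d :: "'a \<Rightarrow> 'a \<Rightarrow> real" +
  fixes S :: "real set"
  assumes universal_spectrum: "universal_spectrum S"
    and urysohn_space: "urysohn_space S M d"
begin

lemma zero_in_S: "0 \<in> S"
  and S_nonneg: "s \<in> S \<Longrightarrow> 0 \<le> s"
  and four_values_S: "four_values S"
  using universal_spectrum by (auto simp: universal_spectrum_def)

lemma countable_M: "countable M"
  using urysohn_space by (simp add: urysohn_space_def)

lemma dist_in_S: "x \<in> M \<Longrightarrow> y \<in> M \<Longrightarrow> d x y \<in> S"
  using urysohn_space by (auto simp: urysohn_space_def spectrum_def)

lemma dist_diff_le:
  assumes "x \<in> M" "y \<in> M" "z \<in> M"
  shows "\<bar>d x z - d y z\<bar> \<le> d x y"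
  using triangle[OF assms] triangle[OF assms(2,1,3)] commute[of x y] by linarith

text \<open>\<open>f\<close> prescribes the distances of a further point from the points of
  \<open>A\<close>. Positivity keeps that point outside \<open>A\<close>; the other inequalities are
  the triangle inequalities.\<close>

definition katetov :: "'a set \<Rightarrow> ('a \<Rightarrow> real) \<Rightarrow> bool" where
  "katetov A f \<longleftrightarrow> (\<forall>a\<in>A. f a \<in> S \<and> 0 < f a) \<and>
     (\<forall>a\<in>A. \<forall>b\<in>A. \<bar>f a - f b\<bar> \<le> d a b \<and> d a b \<le> f a + f b)"

text \<open>A copy of \<open>A\<close> with one point added at the prescribed distances is a finite
  space over \<open>S\<close>. Universality embeds it in \<open>M\<close>, and homogeneity carries
  the embedded copy of \<open>A\<close> back onto \<open>A\<close>, taking the new point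
  along.\<close>

lemma katetov_realized:
  assumes "finite A" "A \<subseteq> M" "katetov A f"
  obtains x where "x \<in> M" "\<And>a. a \<in> A \<Longrightarrow> d x a = f a"
proof -
  define n where "n = card A"
  obtain \<alpha> where \<alpha>: "bij_betw \<alpha> {0..<n} A"
    using ex_bij_betw_nat_finite[OF assms(1)] n_def by blast
  have \<alpha>A: "\<alpha> i \<in> A" "\<alpha> i \<in> M" if "i < n" for i
    using \<alpha> that assms(2) by (auto simp: bij_betw_def)
  have \<alpha>inj: "\<alpha> i = \<alpha> j \<longleftrightarrow> i = j" if "i < n" "j < n" for i j
    using \<alpha> that by (auto simp: bij_betw_def inj_on_def)
  have fS: "f a \<in> S" "0 < f a" if "a \<in> A" for a
    using assms(3) that by (auto simp: katetov_def)
  have f: "f a \<le> f b + d a b" "d a b \<le> f a + f b" if "a \<in> A" "b \<in> A" for a b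
    using assms(3) that unfolding katetov_def by (auto simp: abs_le_iff algebra_simps)
  \<comment> \<open>Numbers below \<open>n\<close> represent \<open>A\<close>, and \<open>n\<close>
    is the new point. The value 0 beyond \<open>n\<close> serves nonnegativity and symmetry, which
    \<open>Metric_space\<close> demands of all arguments.\<close>
  define e where "e i j = (if i = j \<or> n < i \<or> n < j then 0 else if i = n then f (\<alpha> j)
    else if j = n then f (\<alpha> i) else d (\<alpha> i) (\<alpha> j))" for i j
  have e_nonneg: "0 \<le> e i j" for i j
    using \<alpha>A(1) fS(2) nonneg by (auto simp: e_def less_imp_le)
  have "finite_space_over S {0..n} e"
    unfolding finite_space_over_def
  proof (intro conjI)
    show "Metric_space {0..n} e"
    proof
      fix i j
      show "0 \<le> e i j"
        by (rule e_nonneg)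
      show "e i j = e j i"
        by (auto simp: e_def commute)
    next
      fix i j assume ij: "i \<in> {0..n}" "j \<in> {0..n}"
      have "f (\<alpha> k) \<noteq> 0" if "k < n" for k
        using fS(2)[OF \<alpha>A(1)[OF that]] by simp
      moreover have "d (\<alpha> i) (\<alpha> j) = 0 \<longleftrightarrow> i = j" if "i < n" "j < n"
        using zero[OF \<alpha>A(2)[OF that(1)] \<alpha>A(2)[OF that(2)]] \<alpha>inj[OF that] by simp
      ultimately show "e i j = 0 \<longleftrightarrow> i = j"
        using ij by (auto simp: e_def)
    next
      fix i j k assume "i \<in> {0..n}" "j \<in> {0..n}" "k \<in> {0..n}"
      then have ijk: "i \<le> n" "j \<le> n" "k \<le> n" by auto
      consider "i = j" | "j = k" | "i = k" | "i \<noteq> j" "j \<noteq> k" "i \<noteq> k" by blast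
      then show "e i k \<le> e i j + e j k"
      proof cases
        case 3
        then show ?thesis using e_nonneg[of i j] e_nonneg[of j k] by (simp add: e_def)
      next
        case 4
        have tri: "d (\<alpha> i) (\<alpha> k) \<le> d (\<alpha> i) (\<alpha> j) + d (\<alpha> j) (\<alpha> k)"
          if "i < n" "j < n" "k < n"
          using that \<alpha>A(2) by (intro triangle)
        have Kat: "f (\<alpha> p) \<le> f (\<alpha> q) + d (\<alpha> p) (\<alpha> q)" "f (\<alpha> p) \<le> f (\<alpha> q) + d (\<alpha> q) (\<alpha> p)"
          "d (\<alpha> p) (\<alpha> q) \<le> f (\<alpha> p) + f (\<alpha> q)" if "p < n" "q < n" for p q
          using f[OF \<alpha>A(1)[OF that(1)] \<alpha>A(1)[OF that(2)]] by (simp_all add: commute)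
        consider "i = n" "j < n" "k < n" | "j = n" "i < n" "k < n" | "k = n" "i < n" "j < n"
          | "i < n" "j < n" "k < n" using 4 ijk by linarith
        then show ?thesis
        proof cases
          case 1
          then show ?thesis using 4 Kat(2)[of k j] by (simp add: e_def)
        next
          case 2
          then show ?thesis using 4 Kat(3)[of i k] by (simp add: e_def)
        next
          case 3
          then show ?thesis using 4 Kat(1)[of i j] by (simp add: e_def)
        next
          case 4
          then show ?thesis using \<open>i \<noteq> j\<close> \<open>j \<noteq> k\<close> \<open>i \<noteq> k\<close> tri by (simp add: e_def)
        qed
      qed (auto simp: e_def)
    qed
    show "spectrum {0..n} e \<subseteq> S"
    proof -
      have "f (\<alpha> i) \<in> S" if "i < n" for i
        using fS(1) \<alpha>A(1) that by blast
      moreover have "d (\<alpha> i) (\<alpha> j) \<in> S" if "i < n" "j < n" for i j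
        using dist_in_S \<alpha>A(2) that by blast
      ultimately have "e i j \<in> S" if "i \<le> n" "j \<le> n" for i j
        using that zero_in_S unfolding e_def by simp
      then show ?thesis by (auto simp: spectrum_def)
    qed
  qed simp
  then obtain h where h: "h ` {0..n} \<subseteq> M" "preserves_dist {0..n} e d h"
    using urysohn_space unfolding urysohn_space_def universal_space_def by blast
  then have hM: "h i \<in> M" and hd: "j \<le> n \<Longrightarrow> d (h i) (h j) = e i j" if "i \<le> n" for i j
    using that by (auto simp: preserves_dist_def)
  have hinj: "inj_on h {0..<n}"
  proof (rule inj_onI)
    fix i j assume ij: "i \<in> {0..<n}" "j \<in> {0..<n}" "h i = h j"
    then have "e i j = 0" using hd[of i j] hM[of i] by auto
    then show "i = j" using ij \<alpha>A \<alpha>inj by (auto simp: e_def split: if_splits)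
  qed
  define \<phi> where "\<phi> = \<alpha> \<circ> the_inv_into {0..<n} h"
  have \<phi>: "\<phi> (h i) = \<alpha> i" if "i < n" for i
    unfolding \<phi>_def using that the_inv_into_f_f[OF hinj] by simp
  have "bij_betw \<phi> (h ` {0..<n}) A"
    unfolding \<phi>_def by (rule bij_betw_trans[OF bij_betw_the_inv_into[OF inj_on_imp_bij_betw[OF hinj]] \<alpha>])
  moreover have "preserves_dist (h ` {0..<n}) d d \<phi>"
    unfolding preserves_dist_def using \<alpha>A by (auto simp: \<phi> hd e_def)
  moreover have "h ` {0..<n} \<subseteq> M" using hM by auto
  ultimately obtain g where g: "automorphism M d g" "\<forall>x\<in>h ` {0..<n}. g x = \<phi> x"
    using urysohn_space assms(2) unfolding urysohn_space_def homogeneous_space_def by blast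
  show ?thesis
  proof
    show "g (h n) \<in> M"
      using g(1) hM by (auto simp: automorphism_def bij_betw_def)
    fix a assume "a \<in> A"
    then obtain i where i: "i < n" "a = \<alpha> i"
      using \<alpha> by (auto simp: bij_betw_def)
    then have "d (g (h n)) a = d (g (h n)) (g (h i))"
      using g(2) \<phi> by auto
    also have "\<dots> = e n i"
      using g(1) i hM hd by (simp add: automorphism_def preserves_dist_def)
    finally show "d (g (h n)) a = f a"
      using i by (simp add: e_def)
  qed
qed

text \<open>The interval of admissible distances from \<open>w\<close> is determined by two of the points of \<open>B\<close>,
  so that one instance of the 4-values condition suffices.\<close>

lemma katetov_extension_value:
  assumes "finite B" "B \<subseteq> M" "katetov B f" "w \<in> M" "w \<notin> B"
  obtains t where "t \<in> S" "0 < t" "\<And>b. b \<in> B \<Longrightarrow> \<bar>f b - d b w\<bar> \<le> t \<and> t \<le> f b + d b w"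
proof (cases "B = {}")
  case True
  then show ?thesis
    using that universal_spectrum by (auto simp: universal_spectrum_def)
next
  case False
  define lo where "lo b = \<bar>f b - d b w\<bar>" for b
  define hi where "hi b = f b + d b w" for b
  obtain b1 where b1: "b1 \<in> B" "\<And>b. b \<in> B \<Longrightarrow> lo b \<le> lo b1"
    using ex_is_arg_min_if_finite[OF assms(1) False, of "\<lambda>b. - lo b"]
    by (force simp: is_arg_min_linorder)
  obtain b2 where b2: "b2 \<in> B" "\<And>b. b \<in> B \<Longrightarrow> hi b2 \<le> hi b"
    using ex_is_arg_min_if_finite[OF assms(1) False, of hi] by (force simp: is_arg_min_linorder)
  have dw: "0 < d b w" "d b w \<in> S" "f b \<in> S" "0 < f b" "b \<in> M" if "b \<in> B" for b
    using that assms dist_in_S[of b w] mdist_pos_less[of b w] by (auto simp: katetov_def)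
  have "\<exists>t\<in>S. 0 < t \<and> lo b1 \<le> t \<and> t \<le> hi b2"
  proof (cases "b1 = b2")
    case True
    \<comment> \<open>When a single point gives both bounds, the larger of its two distances lies in
      the interval and belongs to \<open>S\<close>.\<close>
    then show ?thesis
      using dw[OF b1(1)] unfolding lo_def hi_def
      by (intro bexI[of _ "max (f b1) (d b1 w)"]) (auto simp: max_def)
  next
    case False
    have k: "\<bar>f b1 - f b2\<bar> \<le> d b1 b2" "d b1 b2 \<le> f b1 + f b2"
      using assms(3) b1(1) b2(1) unfolding katetov_def by auto
    have t: "d b1 b2 \<le> d b1 w + d b2 w" "\<bar>d b1 w - d b2 w\<bar> \<le> d b1 b2"
      using triangle[of b1 w b2] dist_diff_le[of b1 b2 w] dw(5)[OF b1(1)] dw(5)[OF b2(1)] assms(4)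
      by (auto simp: commute)
    \<comment> \<open>The two triangles share the side from \<open>b1\<close> to \<open>b2\<close>.
      One apex is the virtual point with distances \<open>f\<close>, the other is
      \<open>w\<close>.\<close>
    have "\<exists>t\<in>S. 0 < t \<and> \<bar>f b1 - d b1 w\<bar> \<le> t \<and> t \<le> f b1 + d b1 w
       \<and> \<bar>f b2 - d b2 w\<bar> \<le> t \<and> t \<le> f b2 + d b2 w"
      using k t False dw[OF b1(1)] dw[OF b2(1)]
      by (intro four_valuesD[OF four_values_S zero_in_S dist_in_S[of b1 b2]])
        (auto intro: mdist_pos_less)
    then show ?thesis
      unfolding lo_def hi_def by blast
  qed
  then obtain t where t: "t \<in> S" "0 < t" "lo b1 \<le> t" "t \<le> hi b2" by blast
  show ?thesis
  proof (rule that[OF t(1,2)])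
    show "\<bar>f b - d b w\<bar> \<le> t \<and> t \<le> f b + d b w" if "b \<in> B" for b
      using b1(2)[OF that] b2(2)[OF that] t(3,4) unfolding lo_def hi_def by linarith
  qed
qed

lemma katetov_insert:
  assumes "A \<subseteq> M" "w \<in> M" "w \<notin> A" "katetov A f" "t \<in> S" "0 < t"
    and "\<And>a. a \<in> A \<Longrightarrow> \<bar>f a - d a w\<bar> \<le> t \<and> t \<le> f a + d a w"
  shows "katetov (insert w A) (f(w := t))"
  unfolding katetov_def
proof (intro conjI ballI)
  fix a b assume ab: "a \<in> insert w A" "b \<in> insert w A"
  have w: "\<bar>f a - t\<bar> \<le> d a w" "\<bar>t - f a\<bar> \<le> d w a" "d a w \<le> f a + t" "d w a \<le> t + f a" "a \<noteq> w"
    if "a \<in> A" for a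
    using assms(3) assms(7)[OF that] that commute[of w a] by auto
  have A: "\<bar>f a - f b\<bar> \<le> d a b" "d a b \<le> f a + f b" if "a \<in> A" "b \<in> A" for a b
    using assms(4) that unfolding katetov_def by auto
  have "d w w = 0" using zero[OF assms(2,2)] by simp
  with ab w A show "\<bar>(f(w := t)) a - (f(w := t)) b\<bar> \<le> d a b" "d a b \<le> (f(w := t)) a + (f(w := t)) b"
    using assms(6) by (cases "a = w"; cases "b = w"; simp)+
qed (use assms in \<open>auto simp: katetov_def\<close>)

text \<open>Points of \<open>C\<close> are added one by one, each with the maximum of an admissible
  value and \<open>e\<close>. The maximum is still admissible: the upper bounds are at least
  \<open>e\<close>, by hypothesis for points of \<open>B\<close> and by induction for points added
  earlier.\<close>

lemma katetov_extend:
  assumes "finite C" "finite B" "B \<union> C \<subseteq> M" "katetov B f" "e \<in> S"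
    and "\<And>b c. b \<in> B \<Longrightarrow> c \<in> C - B \<Longrightarrow> e \<le> f b + d b c"
  shows "\<exists>f'. katetov (B \<union> C) f' \<and> (\<forall>b\<in>B. f' b = f b) \<and> (\<forall>c\<in>C - B. e \<le> f' c)"
  using assms(1,3,6)
proof (induction C)
  case empty
  then show ?case using assms(4) by auto
next
  case (insert w C)
  then obtain f' where f': "katetov (B \<union> C) f'" "\<forall>b\<in>B. f' b = f b" "\<forall>c\<in>C - B. e \<le> f' c"
    by auto
  show ?case
  proof (cases "w \<in> B")
    case True
    then have "B \<union> insert w C = B \<union> C" "insert w C - B = C - B" by auto
    then show ?thesis using f' by auto
  next
    case False
    then have w: "w \<notin> B \<union> C" "w \<in> M" "B \<union> C \<subseteq> M" using insert by auto
    obtain t where t: "t \<in> S" "0 < t"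
      "\<And>b. b \<in> B \<union> C \<Longrightarrow> \<bar>f' b - d b w\<bar> \<le> t \<and> t \<le> f' b + d b w"
      using katetov_extension_value[of "B \<union> C" f' w] f'(1) w insert.hyps assms(2) by auto
    have e: "e \<le> f' b + d b w" if "b \<in> B \<union> C" for b
    proof (cases "b \<in> B")
      case True
      then show ?thesis using f'(2) insert.prems(2)[of b w] False by simp
    next
      case False
      then have "e \<le> f' b" using f'(3) that by auto
      then show ?thesis using nonneg[of b w] by linarith
    qed
    have "\<bar>f' b - d b w\<bar> \<le> max t e \<and> max t e \<le> f' b + d b w" if "b \<in> B \<union> C" for b
      using t(3)[OF that] e[OF that] by linarith
    moreover have "max t e \<in> S" "0 < max t e"
      using t assms(5) by (auto simp: max_def)
    ultimately have "katetov (B \<union> insert w C) (f'(w := max t e))"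
      using katetov_insert[OF w(3) w(2) w(1) f'(1)] by (metis Un_insert_right)
    moreover have "\<forall>b\<in>B. (f'(w := max t e)) b = f b" "\<forall>c\<in>insert w C - B. e \<le> (f'(w := max t e)) c"
      using f'(2,3) False by auto
    ultimately show ?thesis by blast
  qed
qed

subsection \<open>Infinitude and the distinguishing number\<close>

text \<open>The constant function \<open>s\<close> is Katetov on an equilateral set of side
  \<open>s\<close>, so such a set can always be enlarged by a point.\<close>

lemma ex_equilateral:
  assumes "s \<in> S" "0 < s"
  shows "\<exists>A. finite A \<and> A \<subseteq> M \<and> card A = n \<and> (\<forall>x\<in>A. \<forall>y\<in>A. x \<noteq> y \<longrightarrow> d x y = s)"
proof (induction n)
  case (Suc n)
  then obtain A where A: "finite A" "A \<subseteq> M" "card A = n" "\<And>x y. x \<in> A \<Longrightarrow> y \<in> A \<Longrightarrow> x \<noteq> y \<Longrightarrow> d x y = s"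
    by metis
  have "d x y \<le> s + s \<and> 0 \<le> d x y" if "x \<in> A" "y \<in> A" for x y
    using A(2) A(4)[OF that] that assms(2) by (cases "x = y") auto
  then have "katetov A (\<lambda>_. s)" using assms by (auto simp: katetov_def)
  then obtain z where z: "z \<in> M" "\<And>a. a \<in> A \<Longrightarrow> d z a = s"
    using katetov_realized[OF A(1,2)] by blast
  then have "z \<notin> A" using assms(2) by fastforce
  then show ?case
    using A z commute by (intro exI[of _ "insert z A"]) auto
qed (intro exI[of _ "{}"], simp)

lemma infinite_M: "infinite M"
proof
  assume "finite M"
  obtain s where "s \<in> S" "0 < s"
    using universal_spectrum by (auto simp: universal_spectrum_def)
  then obtain A where "A \<subseteq> M" "card A = Suc (card M)"
    using ex_equilateral by blast
  then show False using card_mono[OF \<open>finite M\<close>, of A] by simp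
qed

text \<open>Homogeneity extends the map between two single points. This excludes a distinguishing
  partition with only one cell.\<close>

lemma ex_nontrivial_automorphism:
  obtains g x where "automorphism M d g" "x \<in> M" "g x \<noteq> x"
proof -
  obtain x where x: "x \<in> M" using infinite_M by fastforce
  obtain y where y: "y \<in> M" "y \<noteq> x"
    using infinite_M by (metis finite.emptyI finite_insert finite_subset insertI1 subsetI)
  have "bij_betw (\<lambda>_. y) {x} {y}" "preserves_dist {x} d d (\<lambda>_. y)"
    using x y by (auto simp: bij_betw_def preserves_dist_def)
  then obtain g where "automorphism M d g" "\<forall>z\<in>{x}. g z = y"
    using urysohn_space x y unfolding urysohn_space_def homogeneous_space_def
    by (metis (no_types, lifting) empty_subsetI finite.emptyI finite_insert insert_subset)
  then show ?thesis using that x y by auto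
qed

text \<open>The set \<open>X\<close> and its complement give the bound 2; no cell is impossible
  since \<open>M\<close> is nonempty, and one cell since a nontrivial automorphism exists.\<close>

lemma distinguishing_number_two:
  assumes "X \<subseteq> M"
    and "\<And>g x. automorphism M d g \<Longrightarrow> g ` X = X \<Longrightarrow> x \<in> M \<Longrightarrow> g x = x"
  shows "distinguishing_number M d =o ctwo"
proof -
  obtain P where P: "distinguishing_partition M d P" "distinguishing_number M d = |P|"
    "\<And>Q. distinguishing_partition M d Q \<Longrightarrow> |P| \<le>o |Q|"
    using distinguishing_number_least by blast
  \<comment> \<open>A partition has no empty cell, whereas \<open>X\<close> or its complement may be
    empty.\<close>
  define Q where "Q = {X, M - X} - {{}}"
  have XQ: "g ` X = X" if "\<forall>C\<in>Q. g ` C = C" for g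
    using that by (cases "X = {}") (auto simp: Q_def)
  have "partition_on M Q"
    unfolding Q_def partition_on_def disjoint_def using assms(1) by auto
  then have "distinguishing_partition M d Q"
    unfolding distinguishing_partition_def
    by (intro conjI allI impI ballI) (use XQ assms(2) in auto)
  then have PQ: "|P| \<le>o |Q|" by (rule P(3))
  obtain f where f: "inj_on f P" "f ` P \<subseteq> Q"
    using PQ by (auto simp: card_of_ordLeq[symmetric])
  have sub: "f ` P \<subseteq> {X, M - X}" using f(2) by (auto simp: Q_def)
  have "finite P" by (rule inj_on_finite[OF f(1) sub]) simp
  moreover have "card P \<le> card {X, M - X}" by (rule card_inj_on_le[OF f(1) sub]) simp
  moreover have "card {X, M - X} \<le> 2" by (rule card_insert_le_m1) auto
  ultimately have finP: "finite P" "card P \<le> 2" by linarith+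
  have "card P \<noteq> 0"
  proof
    assume "card P = 0"
    then have "M = {}" using P(1) finP by (auto simp: distinguishing_partition_def partition_on_def)
    then show False using infinite_M by simp
  qed
  moreover have "card P \<noteq> 1"
  proof
    assume "card P = 1"
    then obtain C where "P = {C}" by (auto simp: card_1_singleton_iff)
    then have "P = {M}" using P(1) by (auto simp: distinguishing_partition_def partition_on_def)
    moreover obtain g x where "automorphism M d g" "x \<in> M" "g x \<noteq> x"
      by (rule ex_nontrivial_automorphism)
    ultimately show False
      using P(1) by (auto simp: distinguishing_partition_def automorphism_def bij_betw_def)
  qed
  ultimately have "card P = 2" using finP(2) by linarith
  then have "card P = card (UNIV :: bool set)" by simp
  then have "\<exists>f. bij_betw f P (UNIV :: bool set)"
    using finP by (intro finite_same_card_bij) auto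
  then show ?thesis unfolding P(2) ctwo_def by (simp add: card_of_ordIso)
qed

text \<open>A partition of the countable set \<open>M\<close> has countably many cells, so
  infinitely many means exactly countably infinitely many.\<close>

lemma distinguishing_number_omega:
  assumes "\<And>P. distinguishing_partition M d P \<Longrightarrow> infinite P"
  shows "distinguishing_number M d =o natLeq" "\<not> distinguishing_number M d =o ctwo"
proof -
  obtain P where P: "distinguishing_partition M d P" "distinguishing_number M d = |P|"
    using distinguishing_number_least by blast
  have inf: "infinite P" using assms P(1) by blast
  have part: "partition_on M P" using P(1) by (simp add: distinguishing_partition_def)
  have "P \<subseteq> (\<lambda>x. THE C. C \<in> P \<and> x \<in> C) ` M"
  proof
    fix C assume C: "C \<in> P"
    then have "C \<noteq> {}" "C \<subseteq> M" using part by (auto simp: partition_on_def)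
    then obtain x where x: "x \<in> C" "x \<in> M" by blast
    have "(THE C. C \<in> P \<and> x \<in> C) = C"
      using part C x by (intro the_equality) (auto simp: partition_on_def disjoint_def)
    then show "C \<in> (\<lambda>x. THE C. C \<in> P \<and> x \<in> C) ` M" using x by force
  qed
  then have "countable P" by (rule countable_subset) (intro countable_image countable_M)
  from to_nat_on_infinite[OF this inf] have "|P| =o |UNIV :: nat set|"
    by (rule card_of_ordIsoI)
  then show "distinguishing_number M d =o natLeq"
    unfolding P(2) using card_of_nat by (rule ordIso_transitive)
  show "\<not> distinguishing_number M d =o ctwo"
  proof
    assume "distinguishing_number M d =o ctwo"
    then have "|P| =o |UNIV :: bool set|" unfolding P(2) ctwo_def .
    then have "finite P \<longleftrightarrow> finite (UNIV :: bool set)" by (rule card_of_ordIso_finite)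
    then show False using inf by simp
  qed
qed

subsection \<open>Close pairs of distances\<close>

text \<open>If the set were finite, the value \<open>r\<close> at \<open>u\<close> would extend to a
  Katetov function on it and on \<open>F\<close> with all other values at least \<open>e\<close>.
  Its realization would belong to the set and so have positive distance from itself.\<close>

lemma infinite_realizations:
  assumes "finite F" "F \<subseteq> M" "u \<in> M" "u \<notin> F" "r \<in> S" "e \<in> S" "0 < r" "r < e" "e \<le> r + r"
    and "\<And>w. w \<in> F \<Longrightarrow> e \<le> r + d u w"
  shows "infinite {x \<in> M. d x u = r \<and> (\<forall>w\<in>F. r < d x w)}" (is "infinite ?T")
proof
  assume fin: "finite ?T"
  have "katetov {u} (\<lambda>_. r)"
    using assms by (auto simp: katetov_def)
  moreover have "e \<le> r + d b c" if "b \<in> {u}" "c \<in> F \<union> ?T - {u}" for b c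
  proof (cases "c \<in> F")
    case True
    then show ?thesis using that assms(10) by simp
  next
    case False
    then have "d u c = r" using that commute by auto
    then show ?thesis using that assms(9) by simp
  qed
  ultimately obtain f where f: "katetov ({u} \<union> (F \<union> ?T)) f" "f u = r"
    "\<And>c. c \<in> F \<union> ?T - {u} \<Longrightarrow> e \<le> f c"
    using katetov_extend[of "F \<union> ?T" "{u}" "\<lambda>_. r" e] assms fin by blast
  obtain x where x: "x \<in> M" "\<And>a. a \<in> {u} \<union> (F \<union> ?T) \<Longrightarrow> d x a = f a"
    using katetov_realized[OF _ _ f(1)] assms fin by auto
  have "r < d x w" if "w \<in> F" for w
    using f(3)[of w] x(2)[of w] that assms by auto
  then have "x \<in> ?T" using x f(2) by auto
  then have "e \<le> f x"
    using assms by (intro f(3)) auto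
  moreover have "f x = 0" using x(2)[of x] \<open>x \<in> ?T\<close> x(1) by auto
  ultimately show False using assms by auto
qed

text \<open>Point number \<open>j\<close> is recognised by having at least \<open>2 ^ j\<close> members of \<open>X\<close> at distance
  \<open>r j\<close>, whereas fewer are at distance \<open>r j\<close> from each earlier point.\<close>

lemma distinguishing_number_two_if_close_pairs:
  assumes "R \<subseteq> S" "R \<noteq> {}" "0 \<notin> R"
    and close: "\<And>r \<delta>. r \<in> R \<Longrightarrow> \<delta> \<in> S \<Longrightarrow> 0 < \<delta> \<Longrightarrow> \<exists>r'\<in>R. \<exists>e\<in>S. r \<le> r' \<and> r' < e \<and> e \<le> r' + \<delta>"
  shows "distinguishing_number M d =o ctwo"
proof -
  define m where "m = from_nat_into M"
  have bij: "bij_betw m UNIV M"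
    unfolding m_def by (rule bij_betw_from_nat_into[OF countable_M infinite_M])
  then have mM: "m i \<in> M" and minj: "m i = m j \<longleftrightarrow> i = j" for i j
    by (auto simp: bij_betw_def inj_on_def)
  have Rpos: "0 < r" "r \<in> S" if "r \<in> R" for r
    using that assms(1,3) S_nonneg[of r] by (auto simp: less_le)
  obtain r0 where r0: "r0 \<in> R" using assms(2) by blast
  \<comment> \<open>The gap \<open>e - p\<close> is at most the distance from \<open>m n\<close> to
    each earlier point, as \<open>infinite_realizations\<close> requires, and at most
    \<open>r0\<close>. As the chosen \<open>p\<close> are at least \<open>r0\<close>, the latter
    yields \<open>e \<le> p + p\<close>.\<close>
  have step: "\<exists>p\<in>R. \<exists>e\<in>S. r \<le> p \<and> p < e \<and> e \<le> p + r0 \<and> (\<forall>i<n. e \<le> p + d (m n) (m i))"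
    if r: "r \<in> R" for n r
  proof -
    let ?D = "insert r0 ((\<lambda>i. d (m n) (m i)) ` {..<n})"
    have "?D \<subseteq> S" "\<forall>x\<in>?D. 0 < x"
      using r0 Rpos mM minj by (auto intro: dist_in_S mdist_pos_less)
    moreover have "Min ?D \<in> ?D" by (rule Min_in) auto
    ultimately obtain p e where "p \<in> R" "e \<in> S" "r \<le> p" "p < e" "e \<le> p + Min ?D"
      using close[OF r, of "Min ?D"] by blast
    moreover have "e \<le> p + x" if "x \<in> ?D" for x
      using Min_le[OF _ that] \<open>e \<le> p + Min ?D\<close> by simp
    ultimately show ?thesis by blast
  qed
  let ?P = "\<lambda>n (p, e). p \<in> R \<and> e \<in> S \<and> r0 \<le> p \<and> p < e \<and> e \<le> p + r0 \<and>
      (\<forall>i<n. e \<le> p + d (m n) (m i))"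
  have "\<exists>q. \<forall>n. ?P n (q n) \<and> fst (q n) \<le> fst (q (Suc n))"
  proof (rule dependent_nat_choice)
    show "\<exists>x. ?P 0 x" using step[OF r0, of 0] by auto
    show "\<exists>y. ?P (Suc n) y \<and> fst x \<le> fst y" if x: "?P n x" for x n
    proof -
      have "fst x \<in> R" "r0 \<le> fst x" using x by auto
      then obtain p e where "p \<in> R" "e \<in> S" "fst x \<le> p" "p < e" "e \<le> p + r0"
          "\<forall>i<Suc n. e \<le> p + d (m (Suc n)) (m i)"
        using step by blast
      with \<open>r0 \<le> fst x\<close> have "?P (Suc n) (p, e) \<and> fst x \<le> fst (p, e)" by simp
      then show ?thesis by blast
    qed
  qed
  then obtain q where q: "\<forall>n. ?P n (q n) \<and> fst (q n) \<le> fst (q (Suc n))" ..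
  define r where "r n = fst (q n)" for n
  define e where "e n = snd (q n)" for n
  have re: "r n \<in> R" "e n \<in> S" "r n < e n" "e n \<le> r n + r n" "i < n \<Longrightarrow> e n \<le> r n + d (m n) (m i)" for n i
    using q[rule_format, of n] unfolding r_def e_def by (auto split: prod.splits)
  have mono: "r i \<le> r j" if "i \<le> j" for i j
    using lift_Suc_mono_le[of r, OF _ that] q by (simp add: r_def)
  define T where "T j = {x \<in> M. d x (m j) = r j \<and> (\<forall>w\<in>m ` {..<j}. r j < d x w)}" for j
  have "infinite (T j)" for j
    unfolding T_def using re Rpos[OF re(1)] mM minj
    by (intro infinite_realizations[of _ _ _ "e j"]) auto
  then have "\<exists>Y. Y \<subseteq> T j \<and> finite Y \<and> card Y = 2 ^ j" for j
    using infinite_arbitrarily_large by metis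
  then obtain Y where Y: "\<And>j. Y j \<subseteq> T j" "\<And>j. finite (Y j)" "\<And>j. card (Y j) = 2 ^ j"
    by metis
  define X where "X = (\<Union>j. Y j)"
  have XM: "X \<subseteq> M" unfolding X_def using Y(1) by (auto simp: T_def)
  \<comment> \<open>For \<open>k \<ge> j\<close> the points of \<open>Y k\<close> are farther than
    \<open>r k \<ge> r j\<close> from \<open>m i\<close>. Only the sets \<open>Y k\<close> with
    \<open>k < j\<close> remain, and their sizes add up to at most \<open>2 ^ j - 1\<close>.\<close>
  have few: "finite {x \<in> X. d x (m i) = r j}" "card {x \<in> X. d x (m i) = r j} < 2 ^ j"
    if "i < j" for i j
  proof -
    have sub: "{x \<in> X. d x (m i) = r j} \<subseteq> (\<Union>k\<in>{..<j}. Y k)"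
    proof
      fix x assume x: "x \<in> {x \<in> X. d x (m i) = r j}"
      then obtain k where k: "x \<in> Y k" by (auto simp: X_def)
      have "k < j"
      proof (rule ccontr)
        assume "\<not> k < j"
        then have "r j \<le> r k" "r k < d x (m i)"
          using k Y(1)[of k] \<open>i < j\<close> mono[of j k] by (auto simp: T_def)
        then show False using x by simp
      qed
      then show "x \<in> (\<Union>k\<in>{..<j}. Y k)" using k by blast
    qed
    then show "finite {x \<in> X. d x (m i) = r j}"
      by (rule finite_subset) (use Y(2) in auto)
    have "card {x \<in> X. d x (m i) = r j} \<le> card (\<Union>k\<in>{..<j}. Y k)"
      using sub Y(2) by (intro card_mono) auto
    also have "\<dots> \<le> (\<Sum>k<j. card (Y k))" by (rule card_UN_le) simp
    also have "\<dots> < 2 ^ j" unfolding Y(3) by (induction j) auto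
    finally show "card {x \<in> X. d x (m i) = r j} < 2 ^ j" .
  qed
  have many: "Y j \<subseteq> {x \<in> X. d x (m j) = r j}" for j
    using Y(1)[of j] by (auto simp: X_def T_def)
  show ?thesis
  proof (rule distinguishing_number_two[OF XM])
    fix g x assume g: "automorphism M d g" "g ` X = X" and x: "x \<in> M"
    obtain i where i: "x = m i" using x bij by (auto simp: bij_betw_def)
    obtain j where j: "g x = m j"
      using g(1) x bij by (auto simp: automorphism_def bij_betw_def)
    have ginj: "inj_on g X"
      using g(1) XM by (auto simp: automorphism_def bij_betw_def intro: inj_on_subset)
    have "d (g y) (m j) = d y (m i)" if "y \<in> X" for y
      using g(1) that XM x unfolding j[symmetric] i[symmetric] automorphism_def preserves_dist_def
      by blast
    then have "g ` {y \<in> X. d y (m i) = r k} = {y \<in> g ` X. d y (m j) = r k}" for k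
      by auto
    then have g_sphere: "{y \<in> X. d y (m j) = r k} = g ` {y \<in> X. d y (m i) = r k}" for k
      unfolding g(2) by simp
    \<comment> \<open>\<open>g\<close> maps the members of \<open>X\<close> at a given distance from
      \<open>m i\<close> bijectively to those at that distance from \<open>m j\<close>. The radius
      \<open>r\<close> of the larger index then contradicts the counts.\<close>
    have "\<not> i < j"
    proof
      assume ij: "i < j"
      have "card (Y j) \<le> card {y \<in> X. d y (m i) = r j}"
        using few(1)[OF ij] many[of j] unfolding g_sphere by (rule surj_card_le)
      then show False using few(2)[OF ij] Y(3)[of j] by linarith
    qed
    moreover have "\<not> j < i"
    proof
      assume ji: "j < i"
      have "card (Y i) = card (g ` Y i)"
        using ginj many[of i] by (intro card_image[symmetric] inj_on_subset[OF ginj]) auto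
      also have "\<dots> \<le> card {y \<in> X. d y (m j) = r i}"
        using few(1)[OF ji] many[of i] unfolding g_sphere by (intro card_mono) auto
      finally show False using few(2)[OF ji] Y(3)[of i] by linarith
    qed
    ultimately show "g x = x" using i j by (metis linorder_neqE_nat)
  qed
qed

subsection \<open>Limits from the right\<close>

text \<open>One step of the construction: \<open>x\<close> marks \<open>u\<close> by the label
  \<open>r\<close>, and its distances to the rest of \<open>X\<close> are either \<open>r'\<close>
  or at least \<open>e0\<close>, so they avoid the older labels, which lie between
  \<open>\<rho>\<close> and \<open>e0\<close>. Values just above \<open>l\<close> are compatible
  because their sums exceed \<open>2 * l\<close>.\<close>

lemma labelled_extension:
  assumes "finite X" "finite V" "X \<subseteq> M" "V \<subseteq> M" "u \<in> M" "0 < l"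
    and sep: "\<And>a b. a \<in> X \<Longrightarrow> b \<in> X \<Longrightarrow> a \<noteq> b \<Longrightarrow> l \<le> d a b"
    and "e0 \<in> S" "e0 \<le> 2 * l" "l < \<rho>" "\<rho> \<le> e0"
    and lim: "\<And>\<epsilon>. 0 < \<epsilon> \<Longrightarrow> \<exists>s\<in>S. l < s \<and> s < l + \<epsilon>"
  obtains x r r' where "x \<in> M" "l < r" "r < r'" "r' < \<rho>" "d x u = r"
    "\<And>a. a \<in> X \<Longrightarrow> a \<noteq> u \<Longrightarrow> d x a = r' \<or> e0 \<le> d x a"
    "\<And>v. v \<in> V \<Longrightarrow> v \<noteq> u \<Longrightarrow> r < d x v"
proof -
  \<comment> \<open>The values \<open>r\<close> and \<open>r'\<close> will differ by less than
    \<open>\<delta>\<close>, so that they may be prescribed at \<open>u\<close> and at any other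
    point of \<open>X \<union> V\<close>.\<close>
  obtain \<delta> where \<delta>: "0 < \<delta>" "\<And>w. w \<in> X \<union> V \<Longrightarrow> w \<noteq> u \<Longrightarrow> \<delta> \<le> d u w"
  proof (rule finite_positive_lower_bound[of "d u ` (X \<union> V - {u})"])
    show "finite (d u ` (X \<union> V - {u}))" using assms(1,2) by simp
    show "0 < a" if "a \<in> d u ` (X \<union> V - {u})" for a
      using that assms(3-5) by (auto intro!: mdist_pos_less)
  qed auto
  obtain r' where r': "r' \<in> S" "l < r'" "r' < l + min \<delta> (\<rho> - l)"
    using lim[of "min \<delta> (\<rho> - l)"] \<delta>(1) assms(10) by auto
  obtain r where r: "r \<in> S" "l < r" "r < l + (r' - l)"
    using lim[of "r' - l"] r'(2) by auto
  \<comment> \<open>The points of \<open>X\<close> closer than \<open>l\<close> to \<open>u\<close>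
    cannot be guaranteed a value as large as \<open>e0\<close>; they receive \<open>r'\<close>
    instead.\<close>
  define B where "B = insert u {a \<in> X. a \<noteq> u \<and> d u a < l}"
  define f where "f a = (if a = u then r else r')" for a
  have BM: "B \<subseteq> M" "finite B" using assms by (auto simp: B_def)
  have kat: "katetov B f"
    unfolding katetov_def
  proof (intro conjI ballI)
    fix a b assume ab: "a \<in> B" "b \<in> B"
    have triv: "a = b \<Longrightarrow> d a b = 0" using ab BM by auto
    have ua: "\<delta> \<le> d u c" "\<delta> \<le> d c u" "d u c < l" "d c u < l" if "c \<in> B" "c \<noteq> u" for c
      using that \<delta>(2) commute[of c u] unfolding B_def by auto
    have "d a b \<le> 2 * l"
    proof (cases "a = u \<or> b = u")
      case True
      then show ?thesis using ua ab triv assms(6) by (cases "a = b") fastforce+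
    next
      case False
      have "d a b \<le> d a u + d u b" using ab BM assms(5) by (intro triangle) auto
      then show ?thesis using False ab ua(4)[of a] ua(3)[of b] by linarith
    qed
    moreover have "l < f c" for c using r r' by (simp add: f_def)
    ultimately show "d a b \<le> f a + f b" by (smt (verit))
    have "\<bar>f a - f b\<bar> \<le> \<delta>" "a \<noteq> u \<Longrightarrow> b \<noteq> u \<Longrightarrow> f a = f b"
      using r r' \<delta>(1) by (auto simp: f_def)
    then show "\<bar>f a - f b\<bar> \<le> d a b"
      using ua(1)[of b] ua(2)[of a] ab nonneg[of a b] by (cases "a = u"; cases "b = u") auto
  qed (use r r' assms(6) in \<open>auto simp: f_def\<close>)
  \<comment> \<open>Points of \<open>X\<close> outside \<open>B\<close> are at distance at least
    \<open>l\<close> from \<open>u\<close> by choice of \<open>B\<close> and from the rest of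
    \<open>B\<close> by \<open>sep\<close>, which leaves room for
    \<open>e0 \<le> 2 * l\<close>.\<close>
  have far: "e0 \<le> f b + d b c" if "b \<in> B" "c \<in> X - B" for b c
  proof -
    have "l \<le> d b c"
      using that sep[of b c] by (auto simp: B_def)
    moreover have "l < f b" using r r' by (simp add: f_def)
    ultimately show ?thesis using assms(9) by linarith
  qed
  have BXM: "B \<union> X \<subseteq> M" "finite (B \<union> X)" "B \<union> X \<union> V \<subseteq> M" "finite (B \<union> X \<union> V)"
    using BM assms(1-4) by auto
  obtain f1 where f1: "katetov (B \<union> X) f1" "\<forall>b\<in>B. f1 b = f b" "\<forall>c\<in>X - B. e0 \<le> f1 c"
    using katetov_extend[OF assms(1) BM(2) BXM(1) kat assms(8) far] by blast
  have f1u: "f1 u = r" using f1(2) by (simp add: B_def f_def)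
  have f1ge: "f1 b = r' \<or> e0 \<le> f1 b" if "b \<in> B \<union> X" "b \<noteq> u" for b
    using that f1(2,3) by (cases "b \<in> B") (auto simp: f_def)
  have r'e0: "r' \<le> e0" using r' assms(11) by simp
  \<comment> \<open>The points of \<open>V\<close> come last, with values at least
    \<open>r' > r\<close>. At \<open>u\<close> the room is provided by
    \<open>\<delta>\<close>.\<close>
  have near: "r' \<le> f1 b + d b c" if "b \<in> B \<union> X" "c \<in> V - (B \<union> X)" for b c
  proof (cases "b = u")
    case True
    then show ?thesis using \<delta>(2)[of c] that r r' f1u by (auto simp: B_def)
  next
    case False
    then show ?thesis using f1ge[OF that(1)] r'e0 nonneg[of b c] by linarith
  qed
  obtain f2 where f2: "katetov (B \<union> X \<union> V) f2" "\<forall>b\<in>B \<union> X. f2 b = f1 b"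
    "\<forall>c\<in>V - (B \<union> X). r' \<le> f2 c"
    using katetov_extend[OF assms(2) BXM(2,3) f1(1) r'(1) near] by blast
  obtain x where x: "x \<in> M" "\<And>a. a \<in> B \<union> X \<union> V \<Longrightarrow> d x a = f2 a"
    using katetov_realized[OF BXM(4,3) f2(1)] by blast
  show ?thesis
  proof (rule that[of x r r'])
    show "d x u = r" using x(2)[of u] f2(2) f1u by (simp add: B_def)
    show *: "d x a = r' \<or> e0 \<le> d x a" if "a \<in> X" "a \<noteq> u" for a
      using x(2)[of a] f2(2) f1ge[of a] that by simp
    show "r < d x v" if "v \<in> V" "v \<noteq> u" for v
    proof (cases "v \<in> B \<union> X")
      case True
      then show ?thesis using x(2)[of v] f2(2) f1ge[OF True that(2)] r r'e0 by auto
    next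
      case False
      then show ?thesis using x(2)[of v] f2(3) that r by force
    qed
  qed (use x r r' in auto)
qed

text \<open>The distances \<open>r n\<close> decrease to \<open>l\<close>, and each occurs in the range of \<open>x\<close> for at most one
  pair of points, namely \<open>x n\<close> and \<open>u n\<close>.\<close>

lemma distinguishing_number_two_if_right_limit:
  assumes "0 < l" and lim: "\<And>\<epsilon>. 0 < \<epsilon> \<Longrightarrow> \<exists>s\<in>S. l < s \<and> s < l + \<epsilon>"
  shows "distinguishing_number M d =o ctwo"
proof -
  define m where "m = from_nat_into M"
  have ran: "range m = M"
    unfolding m_def using infinite_M countable_M by (intro range_from_nat_into) auto
  then have mM: "m i \<in> M" for i by auto
  \<comment> \<open>The first component of the decoded pair takes every value infinitely often, so
    each point of \<open>M\<close> is marked infinitely often.\<close>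
  define u where "u n = m (fst (prod_decode n))" for n
  obtain e0 where e0: "e0 \<in> S" "l < e0" "e0 \<le> 2 * l"
    using lim[OF assms(1)] by force
  \<comment> \<open>Entry \<open>n\<close> consists of the new point, its label at
    \<open>u n\<close>, and the only other distance below \<open>e0\<close> that it may have to
    earlier points. Both values lie below all earlier labels, and the label separates
    \<open>u n\<close> from \<open>m 0\<close>, ..., \<open>m n\<close>.\<close>
  define P where "P F n q \<longleftrightarrow> (case q of (x, r, r') \<Rightarrow>
      x \<in> M \<and> l < r \<and> r < r' \<and> r' < e0 \<and> (\<forall>i<n. r' < fst (snd (F i))) \<and> d x (u n) = r \<and>
      (\<forall>i<n. fst (F i) \<noteq> u n \<longrightarrow> d x (fst (F i)) = r' \<or> e0 \<le> d x (fst (F i))) \<and>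
      (\<forall>i\<le>n. m i \<noteq> u n \<longrightarrow> r < d x (m i)))" for F :: "nat \<Rightarrow> 'a \<times> real \<times> real" and n q
  have "\<exists>F. \<forall>n. P F n (F n)"
  proof (rule dependent_wf_choice[OF wf_less])
    show "P F n q = P G n q" if "\<And>k. (k, n) \<in> {(x, y). x < y} \<Longrightarrow> F k = G k" for F G n q
      using that by (auto simp: P_def)
    fix n F assume "\<And>k. (k, n) \<in> {(x, y). x < y} \<Longrightarrow> P F k (F k)"
    then have F: "P F k (F k)" if "k < n" for k using that by simp
    define X where "X = (\<lambda>i. fst (F i)) ` {..<n}"
    have FM: "fst (F i) \<in> M" "l < fst (snd (F i))" if "i < n" for i
      using F[OF that] by (auto simp: P_def split: prod.splits)
    have XM: "X \<subseteq> M" "finite X" using FM(1) by (auto simp: X_def)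
    have "l \<le> d (fst (F j)) (fst (F i))" if "i < j" "j < n" for i j
    proof -
      obtain x r r' where q: "F j = (x, r, r')" by (cases "F j") auto
      show ?thesis
        using F[OF that(2)] that(1) e0(2) unfolding P_def q
        by (cases "fst (F i) = u j") force+
    qed
    then have sep: "l \<le> d a b" if "a \<in> X" "b \<in> X" "a \<noteq> b" for a b
      using that unfolding X_def by (smt (verit) commute imageE lessThan_iff linorder_neqE_nat)
    obtain \<rho> where \<rho>: "l < \<rho>" "\<rho> \<le> e0" "\<And>i. i < n \<Longrightarrow> \<rho> \<le> fst (snd (F i))"
    proof
      let ?A = "insert e0 ((\<lambda>i. fst (snd (F i))) ` {..<n})"
      show "l < Min ?A" using e0 FM(2) by (subst Min_gr_iff) auto
      show "Min ?A \<le> e0" "i < n \<Longrightarrow> Min ?A \<le> fst (snd (F i))" for i by (auto intro: Min_le)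
    qed
    obtain x r r' where "x \<in> M" "l < r" "r < r'" "r' < \<rho>" "d x (u n) = r"
      "\<And>a. a \<in> X \<Longrightarrow> a \<noteq> u n \<Longrightarrow> d x a = r' \<or> e0 \<le> d x a"
      "\<And>v. v \<in> m ` {..n} \<Longrightarrow> v \<noteq> u n \<Longrightarrow> r < d x v"
      by (rule labelled_extension[of X "m ` {..n}" "u n" l e0 \<rho>])
        (use XM mM sep e0 \<rho> lim assms(1) in \<open>auto simp: u_def\<close>)
    then have "P F n (x, r, r')" using \<rho> by (force simp: P_def X_def)
    then show "\<exists>q. P F n q" ..
  qed
  then obtain F where F: "\<forall>n. P F n (F n)" ..
  define x where "x n = fst (F n)" for n
  define r where "r n = fst (snd (F n))" for n
  define r' where "r' n = snd (snd (F n))" for n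
  have xM: "x n \<in> M" and rr': "l < r n" "r n < r' n" "r' n < e0" "i < n \<Longrightarrow> r' n < r i"
    and xu: "d (x n) (u n) = r n"
    and xx: "i < n \<Longrightarrow> x i \<noteq> u n \<Longrightarrow> d (x n) (x i) = r' n \<or> e0 \<le> d (x n) (x i)"
    and xm: "i \<le> n \<Longrightarrow> m i \<noteq> u n \<Longrightarrow> r n < d (x n) (m i)" for n i
    using F[rule_format, of n] by (auto simp: P_def x_def r_def r'_def split: prod.splits)
  \<comment> \<open>As \<open>r p < r' p < r i\<close> for \<open>i < p\<close>, a label is never
    equal to any \<open>r' p\<close>, and it is below \<open>e0\<close>. So it occurs only where it
    was assigned.\<close>
  have later: "p = n \<and> x q = u n" if "q < p" "d (x p) (x q) = r n" for p q n
  proof -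
    have lt: "r' k < r i" if "i < k" for i k using rr'(4) that by blast
    have "r n \<noteq> r' p" "r n = r p \<Longrightarrow> p = n"
      using lt[of n p] lt[of p n] rr'(2)[of n] rr'(2)[of p] by (cases n p rule: linorder_cases; simp)+
    moreover have "r n < e0" using rr'(2,3)[of n] by linarith
    ultimately show ?thesis using xx[OF that(1)] xu[of p] that(2) by force
  qed
  have label: "y = x n \<and> z = u n \<or> y = u n \<and> z = x n"
    if yz: "y \<in> range x" "z \<in> range x" "d y z = r n" for y z n
  proof -
    obtain p q where pq: "y = x p" "z = x q" using yz(1,2) by blast
    have "p \<noteq> q" using pq yz(3) rr'(1)[of n] assms(1) xM[of p] by auto
    then consider "q < p" | "p < q" by linarith
    then show ?thesis
    proof cases
      case 1
      then show ?thesis using later[of q p n] yz(3) pq by blast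
    next
      case 2
      have "d (x q) (x p) = r n" using commute yz(3) pq by metis
      then show ?thesis using later[of p q n] 2 pq by blast
    qed
  qed
  have xinj: "x p \<noteq> x q" if "p \<noteq> q" for p q
  proof -
    have "0 < d (x j) (x i)" if "i < j" for i j
      using xx[OF that] xu[of j] rr'(1,2)[of j] e0(2) assms(1) by (cases "x i = u j") auto
    from this[of p q] this[of q p] show ?thesis
      using that mdist_zero[OF xM] by (cases p q rule: linorder_cases) auto
  qed
  show ?thesis
  proof (rule distinguishing_number_two[of "range x"])
    show "range x \<subseteq> M" using xM by auto
    fix g v assume g: "automorphism M d g" "g ` range x = range x" and v: "v \<in> M"
    have gd: "d (g a) (g b) = d a b" if "a \<in> M" "b \<in> M" for a b
      using g(1) that by (simp add: automorphism_def preserves_dist_def)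
    have gX: "g a \<in> range x" if "a \<in> range x" for a using g(2) that by blast
    \<comment> \<open>If \<open>x i = u n\<close>, the unordered pair of \<open>x n\<close> and
      \<open>x i\<close> is the only one with distance \<open>r n\<close>, hence is preserved by
      \<open>g\<close>. Two different such \<open>n\<close> leave \<open>x i\<close> as the only
      possible image of \<open>x i\<close>.\<close>
    have gx: "g (x i) = x i" for i
    proof -
      obtain k where k: "x i = m k" using xM[of i] ran by auto
      have "g (x i) = x i \<or> g (x i) = x (prod_encode (k, t))" for t
      proof -
        let ?n = "prod_encode (k, t)"
        have un: "u ?n = x i" by (simp add: u_def k)
        then have "d (g (x ?n)) (g (x i)) = r ?n" using gd[OF xM xM] xu[of ?n] by simp
        then show ?thesis
          using label[of "g (x ?n)" "g (x i)" ?n] gX un by auto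
      qed
      from this[of 0] this[of 1] show ?thesis
        using xinj[of "prod_encode (k, 0)" "prod_encode (k, 1)"] by auto
    qed
    show "g v = v"
    proof (rule ccontr)
      assume neq: "g v \<noteq> v"
      have "g v \<in> M" using g(1) v by (auto simp: automorphism_def bij_betw_def)
      then obtain k j where kj: "v = m k" "g v = m j" using v ran by (metis imageE)
      \<comment> \<open>This index marks \<open>v\<close> and is at least \<open>j\<close>, so
        \<open>x ?n\<close>, which \<open>g\<close> fixes, has different distances to
        \<open>v\<close> and to \<open>g v\<close>.\<close>
      let ?n = "prod_encode (k, j)"
      have "u ?n = v" by (simp add: u_def kj)
      then have "r ?n < d (x ?n) (g v)"
        using xm[of j ?n] le_prod_encode_2[of j k] neq kj(2) by simp
      moreover have "d (x ?n) (g v) = r ?n"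
        using gd[OF xM v, of ?n] gx xu[of ?n] \<open>u ?n = v\<close> by simp
      ultimately show False by simp
    qed
  qed
qed

subsection \<open>Colourings with nontrivial automorphisms\<close>

lemma cell_unique:
  assumes "distinguishing_partition M d P" "C \<in> P" "D \<in> P" "x \<in> C" "x \<in> D"
  shows "C = D"
  using assms by (auto simp: distinguishing_partition_def partition_on_def disjoint_def)

text \<open>By the pigeonhole principle some cell contains two points at distance \<open>s\<close>.
  Their distances to a third point differ by at most \<open>s\<close>, hence not at all by
  \<open>gap\<close>, so transposing the two is an automorphism.\<close>

lemma infinite_distinguishing_partition_if_no_limit:
  assumes "s \<in> S" "0 < s"
    and gap: "\<And>a b. a \<in> S \<Longrightarrow> b \<in> S \<Longrightarrow> 0 < a \<Longrightarrow> a < b \<Longrightarrow> s < b - a"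
    and P: "distinguishing_partition M d P"
  shows "infinite P"
proof
  assume fin: "finite P"
  have part: "partition_on M P" using P by (simp add: distinguishing_partition_def)
  obtain A where A: "finite A" "A \<subseteq> M" "card A = Suc (card P)"
    "\<forall>x\<in>A. \<forall>y\<in>A. x \<noteq> y \<longrightarrow> d x y = s"
    using ex_equilateral[OF assms(1,2), of "Suc (card P)"] by (elim exE conjE)
  have "\<forall>x\<in>M. \<exists>C. C \<in> P \<and> x \<in> C" using part by (auto simp: partition_on_def)
  then obtain c where c: "\<And>x. x \<in> M \<Longrightarrow> c x \<in> P \<and> x \<in> c x" by metis
  have "c ` A \<subseteq> P" using c A(2) by auto
  then have "\<not> inj_on c A" using A(3) card_inj_on_le[of c A P] fin by auto
  then obtain x y where xy: "x \<in> A" "y \<in> A" "x \<noteq> y" "c x = c y" by (auto simp: inj_on_def)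
  then have xyM: "x \<in> M" "y \<in> M" and dxy: "d x y = s" using A(2,4) by auto
  have same: "d x z = d y z" if z: "z \<in> M" "z \<noteq> x" "z \<noteq> y" for z
  proof (rule ccontr)
    assume "d x z \<noteq> d y z"
    moreover have "\<bar>d x z - d y z\<bar> \<le> s" using dist_diff_le[OF xyM z(1)] dxy by simp
    moreover have "0 < d x z" "0 < d y z" "d x z \<in> S" "d y z \<in> S"
      using xyM z by (auto intro: dist_in_S mdist_pos_less)
    ultimately show False using gap[of "d x z" "d y z"] gap[of "d y z" "d x z"] by linarith
  qed
  define g where "g = id(x := y, y := x)"
  have g: "g x = y" "g y = x" "z \<noteq> x \<Longrightarrow> z \<noteq> y \<Longrightarrow> g z = z" for z
    using xy(3) by (auto simp: g_def)
  have gg: "g (g z) = z" for z using g by (cases "z = x"; cases "z = y"; simp)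
  have gM: "g z \<in> M" if "z \<in> M" for z
    using g that xyM by (cases "z = x"; cases "z = y"; simp)
  have "automorphism M d g"
    unfolding automorphism_def preserves_dist_def
  proof (intro conjI ballI)
    show "bij_betw g M M"
      by (rule bij_betw_byWitness[where f' = g]) (use gg gM in auto)
    fix p q assume pq: "p \<in> M" "q \<in> M"
    have sym: "d z x = d z y" if "z \<in> M" "z \<noteq> x" "z \<noteq> y" for z
      using same[OF that] by (simp add: commute)
    show "d (g p) (g q) = d p q"
    proof (cases "p = q")
      case True
      then show ?thesis using pq gM by simp
    next
      case False
      consider "p = x" "q = y" | "p = y" "q = x" | "p \<notin> {x, y}" "q \<notin> {x, y}"
        | "p = x" "q \<notin> {x, y}" | "p = y" "q \<notin> {x, y}" | "p \<notin> {x, y}" "q = x" | "p \<notin> {x, y}" "q = y"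
        using False by auto
      then show ?thesis
        by cases (use g same[of q] sym[of p] pq commute[of x y] in auto)
    qed
  qed
  moreover have "g ` C = C" if "C \<in> P" for C
  proof -
    have "x \<in> C \<longleftrightarrow> y \<in> C"
      using c[OF xyM(1)] c[OF xyM(2)] xy(4) cell_unique[OF P that] by metis
    then have gC: "g z \<in> C" if "z \<in> C" for z
      using that g by metis
    show ?thesis
    proof
      show "g ` C \<subseteq> C" using gC by blast
      show "C \<subseteq> g ` C"
      proof
        fix z assume "z \<in> C"
        then show "z \<in> g ` C" using gC[of z] gg[of z] image_eqI[of z g "g z" C] by simp
      qed
    qed
  qed
  ultimately have "g x = x" using P xyM(1) by (auto simp: distinguishing_partition_def)
  then show False using g(1) xy(3) by simp
qed

text \<open>The cells are treated one after another: one that is not dense in the current ball is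
  absent from some smaller ball, and both alternatives are inherited by smaller balls.\<close>

lemma ex_mball_dense_or_absent:
  assumes "finite Q"
  shows "\<exists>p t. p \<in> M \<and> 0 < t \<and>
    (\<forall>C\<in>Q. C \<inter> mball p t = {} \<or> (\<forall>q\<in>mball p t. \<forall>\<delta>>0. C \<inter> mball q \<delta> \<noteq> {}))"
  using assms
proof (induction Q)
  case empty
  have "M \<noteq> {}" using infinite_M by auto
  then show ?case by (auto intro: exI[of _ 1])
next
  case (insert C Q)
  then obtain p t where pt: "p \<in> M" "0 < t"
    "\<And>C. C \<in> Q \<Longrightarrow> C \<inter> mball p t = {} \<or> (\<forall>q\<in>mball p t. \<forall>\<delta>>0. C \<inter> mball q \<delta> \<noteq> {})" by metis
  show ?case
  proof (cases "\<forall>q\<in>mball p t. \<forall>\<delta>>0. C \<inter> mball q \<delta> \<noteq> {}")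
    case True
    with pt show ?thesis by (metis insert_iff)
  next
    case False
    then obtain q \<delta> where q: "q \<in> mball p t" "0 < \<delta>" "C \<inter> mball q \<delta> = {}" by blast
    \<comment> \<open>The new ball lies both in the old one and in the one that \<open>C\<close>
      misses.\<close>
    define t' where "t' = min \<delta> (t - d p q)"
    have qM: "q \<in> M" "0 < t'" using q by (auto simp: t'_def)
    have "mball q t' \<subseteq> mball p t"
      by (rule mball_subset) (use pt(1) commute[of q p] in \<open>auto simp: t'_def\<close>)
    moreover have "C \<inter> mball q t' = {}" using q(3) by (auto simp: t'_def)
    moreover have "D \<inter> mball q t' = {} \<or> (\<forall>q\<in>mball q t'. \<forall>\<delta>>0. D \<inter> mball q \<delta> \<noteq> {})"
      if "D \<in> Q" and sub: "mball q t' \<subseteq> mball p t" for D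
      using pt(3)[OF that(1)]
    proof
      assume "D \<inter> mball p t = {}"
      then have "D \<inter> mball q t' = {}" using sub by blast
      then show ?thesis ..
    next
      assume "\<forall>q\<in>mball p t. \<forall>\<delta>>0. D \<inter> mball q \<delta> \<noteq> {}"
      then have "\<forall>q\<in>mball q t'. \<forall>\<delta>>0. D \<inter> mball q \<delta> \<noteq> {}" using sub by (meson subsetD)
      then show ?thesis ..
    qed
    ultimately have "\<forall>D\<in>insert C Q. D \<inter> mball q t' = {} \<or>
        (\<forall>q\<in>mball q t'. \<forall>\<delta>>0. D \<inter> mball q \<delta> \<noteq> {})"
      by (metis insert_iff)
    with qM show ?thesis by (intro exI conjI)
  qed
qed

lemma isolated_value:
  assumes "\<not> l islimpt S"
  obtains \<delta> where "0 < \<delta>" "\<And>s. s \<in> S \<Longrightarrow> s \<noteq> l \<Longrightarrow> \<delta> \<le> \<bar>s - l\<bar>"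
  using assms unfolding islimpt_approachable dist_real_def by (meson not_less)

text \<open>By compactness \<open>S\<close> has finitely many elements between
  \<open>\<gamma>\<close> and \<open>N + 1\<close>. Pairs from \<open>N\<close> on are covered by
  \<open>far\<close>, and pairs with \<open>a < N\<close> and \<open>b > N + 1\<close> differ by
  more than 1.\<close>

lemma uniform_gap:
  assumes nolim: "\<And>l. 0 < l \<Longrightarrow> \<not> l islimpt S" and "0 < \<gamma>" "0 < \<epsilon>"
    and far: "\<And>a b. a \<in> S \<Longrightarrow> b \<in> S \<Longrightarrow> N \<le> a \<Longrightarrow> a < b \<Longrightarrow> \<epsilon> \<le> b - a"
  obtains \<eta> where "0 < \<eta>" "\<And>a b. a \<in> S \<Longrightarrow> b \<in> S \<Longrightarrow> \<gamma> \<le> a \<Longrightarrow> a < b \<Longrightarrow> \<eta> \<le> b - a"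
proof -
  define K where "K = S \<inter> {\<gamma>..N + 1}"
  have "finite ({\<gamma>..N + 1} \<inter> S)"
    by (rule finite_not_islimpt_in_compact) (use nolim assms(2) in auto)
  then have "finite K" by (simp add: K_def Int_commute)
  define A where "A = (\<lambda>(a, b). b - a) ` {(a, b) \<in> K \<times> K. a < b}"
  have "finite A" unfolding A_def
    by (intro finite_imageI finite_subset[OF _ finite_cartesian_product[OF \<open>finite K\<close> \<open>finite K\<close>]]) auto
  then obtain \<eta> where \<eta>: "0 < \<eta>" "\<And>a. a \<in> A \<Longrightarrow> \<eta> \<le> a"
    by (rule finite_positive_lower_bound) (auto simp: A_def)
  show ?thesis
  proof
    show "0 < min \<eta> (min \<epsilon> 1)" using \<eta>(1) assms(3) by simp
    fix a b assume ab: "a \<in> S" "b \<in> S" "\<gamma> \<le> a" "a < b"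
    show "min \<eta> (min \<epsilon> 1) \<le> b - a"
    proof (cases "N \<le> a")
      case True
      then show ?thesis using far[OF ab(1,2) True ab(4)] by simp
    next
      case aN: False
      show ?thesis
      proof (cases "b \<le> N + 1")
        case True
        then have "(a, b) \<in> {(a, b) \<in> K \<times> K. a < b}" using ab by (auto simp: K_def)
        then have "b - a \<in> A" unfolding A_def by (rule rev_image_eqI) simp
        then show ?thesis using \<eta>(2) by fastforce
      next
        case False
        then show ?thesis using aN by simp
      qed
    qed
  qed
qed

text \<open>Some ball \<open>T\<close> meets each cell in a dense set or not at all. A back-and-forth construction
  inside \<open>T\<close> that displaces points by at most \<open>h\<close> yields a colour-preserving isometry of \<open>T\<close>;
  as distinct distances between \<open>T\<close> and its complement differ by more than \<open>h\<close>, it extends by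
  the identity.\<close>

lemma infinite_distinguishing_partition_if_limit_zero:
  assumes nolim: "\<And>l. 0 < l \<Longrightarrow> \<not> l islimpt S" and lim0: "0 islimpt S" and "0 < \<epsilon>"
    and far: "\<And>a b. a \<in> S \<Longrightarrow> b \<in> S \<Longrightarrow> N \<le> a \<Longrightarrow> a < b \<Longrightarrow> \<epsilon> \<le> b - a"
    and P: "distinguishing_partition M d P"
  shows "infinite P"
proof
  assume "finite P"
  then obtain p t where pt: "p \<in> M" "0 < t"
    "\<And>C. C \<in> P \<Longrightarrow> C \<inter> mball p t = {} \<or> (\<forall>q\<in>mball p t. \<forall>\<delta>>0. C \<inter> mball q \<delta> \<noteq> {})"
    using ex_mball_dense_or_absent by metis
  define T where "T = mball p t"
  have TM: "x \<in> M" if "x \<in> T" for x using that by (simp add: T_def)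
  \<comment> \<open>As the radius \<open>t\<close> is not a limit of \<open>S\<close>, distances
    from \<open>p\<close> keep away from \<open>t\<close> on the inside, which separates
    \<open>T\<close> from its complement.\<close>
  obtain \<gamma> where \<gamma>: "0 < \<gamma>" "\<And>s. s \<in> S \<Longrightarrow> s \<noteq> t \<Longrightarrow> \<gamma> \<le> \<bar>s - t\<bar>"
    using isolated_value[OF nolim[OF pt(2)]] by metis
  have out: "\<gamma> \<le> d x z" if "x \<in> T" "z \<in> M" "z \<notin> T" for x z
  proof -
    have "\<gamma> \<le> \<bar>d p x - t\<bar>" "d p x < t" "t \<le> d p z"
      using \<gamma>(2)[of "d p x"] that pt(1) dist_in_S[of p x] by (auto simp: T_def)
    then show ?thesis using triangle[OF pt(1) TM[OF that(1)] that(2)] by linarith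
  qed
  obtain \<eta> where \<eta>: "0 < \<eta>" "\<And>a b. a \<in> S \<Longrightarrow> b \<in> S \<Longrightarrow> \<gamma> \<le> a \<Longrightarrow> a < b \<Longrightarrow> \<eta> \<le> b - a"
  proof (rule uniform_gap[OF nolim \<gamma>(1) \<open>0 < \<epsilon>\<close>])
    show "\<epsilon> \<le> b - a" if "a \<in> S" "b \<in> S" "N \<le> a" "a < b" for a b
      using far that .
  qed auto
  \<comment> \<open>The bound on displacements: below \<open>\<gamma>\<close> it keeps points inside
    \<open>T\<close>, below \<open>\<eta>\<close> it cannot alter distances to points outside
    \<open>T\<close>.\<close>
  obtain h where h: "h \<in> S" "0 < h" "h < \<eta>" "h < \<gamma>"
  proof -
    obtain s where "s \<in> S" "s \<noteq> 0" "dist s 0 < min \<eta> \<gamma>"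
      using lim0 \<eta>(1) \<gamma>(1) unfolding islimpt_approachable by (metis min_less_iff_conj)
    then show ?thesis using that[of s] S_nonneg[of s] by auto
  qed
  have near: "x' \<in> T" if "x \<in> T" "x' \<in> M" "d x x' \<le> h" for x x'
    using out[OF that(1,2)] that(3) h(4) by linarith
  have far_eq: "d x' z = d x z" if "x \<in> T" "x' \<in> T" "d x x' \<le> h" "z \<in> M" "z \<notin> T" for x x' z
  proof -
    have "\<bar>d x z - d x' z\<bar> \<le> h"
      using dist_diff_le[OF TM[OF that(1)] TM[OF that(2)] that(4)] that(3) by linarith
    moreover have "d x z \<in> S" "d x' z \<in> S" using TM that dist_in_S by auto
    ultimately show ?thesis
      using \<eta>(2)[of "d x z" "d x' z"] \<eta>(2)[of "d x' z" "d x z"] out[OF that(1,4,5)] out[OF that(2,4,5)] h(3)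
      by linarith
  qed
  have "\<forall>x\<in>M. \<exists>C. C \<in> P \<and> x \<in> C"
    using P by (auto simp: distinguishing_partition_def partition_on_def)
  then obtain c where c: "\<And>x. x \<in> M \<Longrightarrow> c x \<in> P" "\<And>x. x \<in> M \<Longrightarrow> x \<in> c x" by metis
  have cI: "c x = C" if "x \<in> M" "x \<in> C" "C \<in> P" for x C
    using cell_unique[OF P c(1)[OF that(1)] that(3) c(2)[OF that(1)] that(2)] .
  \<comment> \<open>A relation rather than a function, so that the back step is the forth step for
    the converse.\<close>
  define good where "good Z \<longleftrightarrow>
      (\<forall>a a'. (a, a') \<in> Z \<longrightarrow> a \<in> T \<and> a' \<in> T \<and> c a = c a' \<and> d a a' \<le> h) \<and>
      (\<forall>a a' b b'. (a, a') \<in> Z \<longrightarrow> (b, b') \<in> Z \<longrightarrow> d a b = d a' b')" for Z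
  have goodD: "a \<in> T" "a' \<in> T" "c a = c a'" "d a a' \<le> h" "(b, b') \<in> Z \<Longrightarrow> d a b = d a' b'"
    if "good Z" "(a, a') \<in> Z" for Z a a' b b'
    using that unfolding good_def by blast+
  have good_eq: "a = b \<longleftrightarrow> a' = b'" if "good Z" "(a, a') \<in> Z" "(b, b') \<in> Z" for Z a a' b b'
    using goodD(1,2,5)[OF that(1,2)] goodD(1,2)[OF that(1,3)] that(3) TM
    by (metis zero)
  have good_converse: "good (Z\<inverse>)" if "good Z" for Z
    unfolding good_def using goodD[OF that] commute by (metis converse_iff)
  \<comment> \<open>First a point \<open>y1\<close> with the required distances is found near
    \<open>y\<close> but different from it; then it is replaced by a point \<open>y2\<close> of the
    colour of \<open>y\<close> with the same distances.\<close>
  have forth: "\<exists>y'. y' \<noteq> y \<and> good (insert (y, y') Z)"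
    if Z: "finite Z" "good Z" and y: "y \<in> T" "y \<notin> fst ` Z" for Z y
  proof -
    note gZ = goodD[OF Z(2)]
    define A where "A = snd ` Z"
    define f where "f a' = d y (SOME a. (a, a') \<in> Z)" for a'
    have f: "f a' = d y a" if "(a, a') \<in> Z" for a a'
    proof -
      have "(SOME a. (a, a') \<in> Z) = a"
        using that good_eq[OF Z(2)] by (intro some_equality) auto
      then show ?thesis by (simp add: f_def)
    qed
    have A: "finite A" "A \<subseteq> M" using Z(1) gZ(2) TM by (auto simp: A_def)
    have yM: "y \<in> M" using y TM by blast
    have kat: "katetov A f"
      unfolding katetov_def
    proof (intro conjI ballI)
      fix a' assume "a' \<in> A"
      then obtain a where a: "(a, a') \<in> Z" by (auto simp: A_def)
      then have aM: "a \<in> M" "y \<noteq> a" using gZ(1) TM y(2) by force+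
      show "f a' \<in> S" "0 < f a'" using aM yM f[OF a] by (auto intro: dist_in_S mdist_pos_less)
      fix b' assume "b' \<in> A"
      then obtain b where b: "(b, b') \<in> Z" by (auto simp: A_def)
      then have bM: "b \<in> M" using gZ(1) TM by blast
      have "d a b = d a' b'" using gZ(5)[OF a b] .
      then show "\<bar>f a' - f b'\<bar> \<le> d a' b'" "d a' b' \<le> f a' + f b'"
        using f[OF a] f[OF b] dist_diff_le[OF aM(1) bM yM] triangle[OF aM(1) yM bM]
        by (simp_all add: commute)
    qed
    have "\<exists>y1\<in>M. (\<forall>a'\<in>A. d y1 a' = f a') \<and> 0 < d y1 y \<and> d y1 y \<le> h"
    proof (cases "y \<in> A")
      \<comment> \<open>Here the distance from \<open>y1\<close> to \<open>y\<close> is already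
        prescribed: it is the displacement of the preimage \<open>a\<close> of \<open>y\<close>,
        which is positive because \<open>y\<close> is not in the domain of \<open>Z\<close>.\<close>
      case True
      obtain y1 where y1: "y1 \<in> M" "\<And>a'. a' \<in> A \<Longrightarrow> d y1 a' = f a'"
        using katetov_realized[OF A kat] by blast
      obtain a where a: "(a, y) \<in> Z" using True by (auto simp: A_def)
      have "d y1 y = d a y" using y1(2)[OF True] f[OF a] commute by simp
      moreover have "a \<noteq> y" "a \<in> M" using a y(2) gZ(1) TM by force+
      ultimately have "0 < d y1 y" "d y1 y \<le> h" using gZ(4)[OF a] yM by (simp_all add: mdist_pos_less)
      then show ?thesis using y1 by blast
    next
      case False
      obtain t0 where t0: "t0 \<in> S" "0 < t0" "\<And>b. b \<in> A \<Longrightarrow> \<bar>f b - d b y\<bar> \<le> t0 \<and> t0 \<le> f b + d b y"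
        using katetov_extension_value[OF A kat yM False] by blast
      \<comment> \<open>Here the distance to \<open>y\<close> is free. Every lower bound on it is at
        most a displacement \<open>d a a' \<le> h\<close>, so an admissible value may be cut down to
        \<open>h\<close>.\<close>
      have "\<bar>f a' - d a' y\<bar> \<le> min t0 h \<and> min t0 h \<le> f a' + d a' y" if a': "a' \<in> A" for a'
      proof -
        obtain a where a: "(a, a') \<in> Z" using a' by (auto simp: A_def)
        have "\<bar>f a' - d a' y\<bar> \<le> h"
          using gZ(4)[OF a] f[OF a] dist_diff_le[OF TM TM yM, OF gZ(1,2)[OF a]] commute[of a y] by linarith
        then show ?thesis using t0(3)[OF a'] by linarith
      qed
      moreover have "min t0 h \<in> S" "0 < min t0 h" using t0 h by (auto simp: min_def)
      ultimately have kat': "katetov (insert y A) (f(y := min t0 h))"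
        using katetov_insert[OF A(2) yM False kat] by blast
      obtain y1 where y1: "y1 \<in> M" "\<And>a. a \<in> insert y A \<Longrightarrow> d y1 a = (f(y := min t0 h)) a"
        by (rule katetov_realized[OF _ _ kat']) (use A yM in auto)
      have "d y1 y = min t0 h" "\<forall>a'\<in>A. d y1 a' = f a'"
        using y1(2) False by auto
      then show ?thesis using y1(1) \<open>0 < min t0 h\<close> by (intro bexI[of _ y1]) auto
    qed
    then obtain y1 where y1: "y1 \<in> M" "\<And>a'. a' \<in> A \<Longrightarrow> d y1 a' = f a'" "0 < d y1 y" "d y1 y \<le> h"
      by blast
    have y1T: "y1 \<in> T" using near[OF y(1) y1(1)] y1(4) commute[of y y1] by simp
    have pos: "0 < d y1 v" if "v \<in> insert y A" for v
      using that y1(2,3) kat by (auto simp: katetov_def)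
    \<comment> \<open>The distances from \<open>y1\<close> are positive, hence isolated in
      \<open>S\<close>; all points sufficiently close to \<open>y1\<close> share them.\<close>
    have "\<forall>v\<in>insert y A. \<exists>\<delta>>0. \<forall>s\<in>S. s \<noteq> d y1 v \<longrightarrow> \<delta> \<le> \<bar>s - d y1 v\<bar>"
      using isolated_value[OF nolim[OF pos]] by metis
    then obtain \<Delta> where \<Delta>: "\<And>v. v \<in> insert y A \<Longrightarrow> 0 < \<Delta> v"
      "\<And>v s. v \<in> insert y A \<Longrightarrow> s \<in> S \<Longrightarrow> s \<noteq> d y1 v \<Longrightarrow> \<Delta> v \<le> \<bar>s - d y1 v\<bar>"
      by metis
    obtain \<delta> where \<delta>: "0 < \<delta>" "\<And>a. a \<in> \<Delta> ` insert y A \<Longrightarrow> \<delta> \<le> a"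
      by (rule finite_positive_lower_bound[of "\<Delta> ` insert y A"]) (use A(1) \<Delta>(1) in auto)
    \<comment> \<open>The colour of \<open>y\<close> occurs in \<open>T\<close>, hence is dense
      there.\<close>
    have "c y \<inter> mball p t \<noteq> {}" using c(2)[OF yM] y(1) by (auto simp: T_def)
    then have "c y \<inter> mball y1 \<delta> \<noteq> {}"
      using pt(3)[OF c(1)[OF yM]] y1T \<delta>(1) unfolding T_def by blast
    then obtain y2 where y2: "y2 \<in> c y" "y2 \<in> M" "d y1 y2 < \<delta>" by auto
    have eq: "d y2 v = d y1 v" if "v \<in> insert y A" for v
    proof (rule ccontr)
      assume neq: "d y2 v \<noteq> d y1 v"
      have "v \<in> M" using that A(2) yM by auto
      then have "\<Delta> v \<le> \<bar>d y2 v - d y1 v\<bar>" "\<bar>d y1 v - d y2 v\<bar> \<le> d y1 y2"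
        using \<Delta>(2)[OF that _ neq] dist_in_S[OF y2(2)] dist_diff_le[OF y1(1) y2(2)] by auto
      moreover have "\<delta> \<le> \<Delta> v" using \<delta>(2) that by blast
      ultimately show False using y2(3) by linarith
    qed
    have dyy2: "d y y2 = d y1 y" using eq[of y] commute by simp
    have "y2 \<in> T" using near[OF y(1) y2(2)] dyy2 y1(4) by simp
    moreover have "c y = c y2" using cI[OF y2(2,1) c(1)[OF yM]] by simp
    moreover have ya: "d y a = d y2 a'" if "(a, a') \<in> Z" for a a'
    proof -
      have "a' \<in> A" using that by (force simp: A_def)
      then show ?thesis using eq[of a'] y1(2)[of a'] f[OF that] by simp
    qed
    moreover have "d a y = d a' y2" if "(a, a') \<in> Z" for a a'
      using ya[OF that] by (simp add: commute)
    moreover have "d y y = d y2 y2" using yM y2(2) by simp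
    moreover have "d y y2 \<le> h" using dyy2 y1(4) by simp
    ultimately have "good (insert (y, y2) Z)"
      using gZ y(1) unfolding good_def by blast
    moreover have "y2 \<noteq> y" using dyy2 y1(3) yM by auto
    ultimately show ?thesis by blast
  qed
  have forth': "\<exists>Z'. finite Z' \<and> good Z' \<and> Z \<subseteq> Z' \<and> y \<in> fst ` Z'"
    if Z: "finite Z" "good Z" and y: "y \<in> T" for Z y
  proof (cases "y \<in> fst ` Z")
    case True
    then show ?thesis using Z y by blast
  next
    case False
    then obtain y' where "good (insert (y, y') Z)" using forth[OF Z y] by blast
    then show ?thesis using Z(1) by (intro exI[of _ "insert (y, y') Z"]) auto
  qed
  have back_forth: "\<exists>Z'. finite Z' \<and> good Z' \<and> Z \<subseteq> Z' \<and> y \<in> fst ` Z' \<and> y \<in> snd ` Z'"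
    if Z: "finite Z" "good Z" and y: "y \<in> T" for Z y
  proof -
    obtain Z1 where Z1: "finite Z1" "good Z1" "Z \<subseteq> Z1" "y \<in> fst ` Z1"
      using forth'[OF Z y] by blast
    obtain Z2 where Z2: "finite Z2" "good Z2" "Z1\<inverse> \<subseteq> Z2" "y \<in> fst ` Z2"
      using forth'[OF _ good_converse[OF Z1(2)] y] Z1(1) by auto
    have "Z1 \<subseteq> Z2\<inverse>" "y \<in> snd ` (Z2\<inverse>)" using Z2(3,4) by force+
    then show ?thesis
      using Z1(3,4) Z2(1) good_converse[OF Z2(2)] by (intro exI[of _ "Z2\<inverse>"]) auto
  qed
  have pT: "p \<in> T" using pt by (simp add: T_def)
  have "good {}" by (simp add: good_def)
  \<comment> \<open>Starting with a pair that moves the centre makes the final automorphism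
    nontrivial.\<close>
  then obtain p' where p': "p' \<noteq> p" "good {(p, p')}"
    using forth[OF _ _ pT, of "{}"] by auto
  define en where "en = from_nat_into T"
  have "countable T" by (rule countable_subset[OF _ countable_M]) (use TM in blast)
  then have en: "range en = T"
    unfolding en_def using pT by (intro range_from_nat_into) auto
  have "\<exists>Z. \<forall>n. (finite (Z n) \<and> good (Z n) \<and> (p, p') \<in> Z n) \<and>
      (Z n \<subseteq> Z (Suc n) \<and> en n \<in> fst ` Z (Suc n) \<and> en n \<in> snd ` Z (Suc n))"
  proof (rule dependent_nat_choice)
    show "\<exists>Z. finite Z \<and> good Z \<and> (p, p') \<in> Z" using p'(2) by (intro exI[of _ "{(p, p')}"]) simp
    show "\<exists>Z'. (finite Z' \<and> good Z' \<and> (p, p') \<in> Z') \<and> (Z \<subseteq> Z' \<and> en n \<in> fst ` Z' \<and> en n \<in> snd ` Z')"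
      if "finite Z \<and> good Z \<and> (p, p') \<in> Z" for Z n
      using back_forth[of Z "en n"] that en by (metis rangeI subsetD)
  qed
  then obtain Z where Z: "\<And>n. good (Z n)" "\<And>n. (p, p') \<in> Z n" "\<And>n. Z n \<subseteq> Z (Suc n)"
    "\<And>n. en n \<in> fst ` Z (Suc n)" "\<And>n. en n \<in> snd ` Z (Suc n)" by metis
  have mono: "Z i \<subseteq> Z j" if "i \<le> j" for i j
    using lift_Suc_mono_le[of Z, OF Z(3) that] .
  define R where "R = (\<Union>n. Z n)"
  have "good R"
    unfolding good_def
  proof (intro conjI allI impI)
    fix a a' assume "(a, a') \<in> R"
    then obtain i where i: "(a, a') \<in> Z i" by (auto simp: R_def)
    show "a \<in> T" "a' \<in> T" "c a = c a'" "d a a' \<le> h" using goodD(1-4)[OF Z(1) i] .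
    fix b b' assume "(b, b') \<in> R"
    then obtain j where j: "(b, b') \<in> Z j" by (auto simp: R_def)
    have "(a, a') \<in> Z (max i j)" "(b, b') \<in> Z (max i j)"
      using i j mono[of i "max i j"] mono[of j "max i j"] by auto
    then show "d a b = d a' b'" by (rule goodD(5)[OF Z(1)])
  qed
  note gR = goodD[OF this] and R_eq = good_eq[OF this]
  have total: "\<exists>x'. (x, x') \<in> R" and onto: "\<exists>x'. (x', x) \<in> R" if x: "x \<in> T" for x
  proof -
    obtain n where "x = en n" using x en by auto
    then show "\<exists>x'. (x, x') \<in> R" "\<exists>x'. (x', x) \<in> R"
      using Z(4,5)[of n] unfolding R_def by fastforce+
  qed
  define \<phi> where "\<phi> x = (SOME x'. (x, x') \<in> R)" for x
  have \<phi>: "(x, \<phi> x) \<in> R" if "x \<in> T" for x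
    unfolding \<phi>_def using total[OF that] by (rule someI_ex)
  have \<phi>_eq: "\<phi> x = x'" if "(x, x') \<in> R" for x x'
    using R_eq[OF \<phi>[OF gR(1)[OF that]] that] by simp
  define g where "g x = (if x \<in> T then \<phi> x else x)" for x
  have gT: "g x \<in> T \<longleftrightarrow> x \<in> T" for x
    using gR(2)[OF \<phi>] by (simp add: g_def)
  have gM: "g x \<in> M" if "x \<in> M" for x
    using that gR(2)[OF \<phi>] TM by (simp add: g_def)
  have gd: "d (g x) (g y) = d x y" if "x \<in> M" "y \<in> M" for x y
  proof -
    have mixed: "d (g x) (g y) = d x y" if "x \<in> T" "y \<notin> T" "y \<in> M" for x y
      using far_eq[OF that(1) gR(2,4)[OF \<phi>] that(3,2)] that by (simp add: g_def)
    consider "x \<in> T" "y \<in> T" | "x \<in> T" "y \<notin> T" | "x \<notin> T" "y \<in> T" | "x \<notin> T" "y \<notin> T" by blast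
    then show ?thesis
    proof cases
      case 1
      then show ?thesis using gR(5)[OF \<phi> \<phi>, of x y] by (simp add: g_def)
    next
      case 2
      then show ?thesis using mixed that by blast
    next
      case 3
      then show ?thesis using mixed[of y x] that commute by metis
    qed (simp add: g_def)
  qed
  have cg: "c (g x) = c x" if "x \<in> M" for x
    using gR(3)[OF \<phi>] by (simp add: g_def)
  have gsurj: "\<exists>x\<in>M. g x = y" if "y \<in> M" for y
  proof (cases "y \<in> T")
    case True
    then obtain x where "(x, y) \<in> R" using onto by blast
    then show ?thesis using \<phi>_eq gR(1) TM by (intro bexI[of _ x]) (auto simp: g_def)
  qed (use that in \<open>auto simp: g_def\<close>)
  have "inj_on g M"
    using gd gM by (intro inj_onI) (metis zero)
  then have "automorphism M d g"
    unfolding automorphism_def preserves_dist_def bij_betw_def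
    using gsurj gM gd by (auto simp: image_iff)
  moreover have "g ` C = C" if "C \<in> P" for C
  proof -
    have CM: "C \<subseteq> M" using P that by (auto simp: distinguishing_partition_def partition_on_def)
    have mem: "x \<in> C \<longleftrightarrow> c x = C" if "x \<in> M" for x
      using cI[OF that] c(2)[OF that] \<open>C \<in> P\<close> by blast
    have "g x \<in> C \<longleftrightarrow> x \<in> C" if "x \<in> M" for x
      using mem[OF that] mem[OF gM[OF that]] cg[OF that] by simp
    then show ?thesis using CM gsurj by (auto simp: image_iff subset_iff) metis
  qed
  ultimately have "g p = p" using P pt(1) by (auto simp: distinguishing_partition_def)
  moreover have "g p = p'" using \<phi>_eq[of p p'] Z(2)[of 0] pT by (auto simp: g_def R_def)
  ultimately show False using p'(1) by simp
qed

end

section \<open>The cases according to the limits of \<open>S\<close>\<close>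

theorem mainTheorem1:
  fixes S :: "real set" and M :: "'a set" and d :: "'a \<Rightarrow> 'a \<Rightarrow> real"
  assumes "universal_spectrum S"
    and "urysohn_space S M d"
  shows "(distinguishing_number M d =o ctwo \<or> distinguishing_number M d =o natLeq) \<and>
    ((\<exists>l>0. l islimpt S) \<longrightarrow> distinguishing_number M d =o ctwo) \<and>
    (\<not> (\<exists>l>0. l islimpt S) \<and> 0 islimpt S \<longrightarrow>
      (distinguishing_number M d =o ctwo \<longleftrightarrow>
        (\<forall>N. \<forall>\<epsilon>>0. \<exists>a\<in>S. \<exists>b\<in>S. a < b \<and> a \<ge> N \<and> b - a < \<epsilon>))) \<and>
    (\<not> (\<exists>l. l islimpt S) \<longrightarrow>
      (distinguishing_number M d =o ctwo \<longleftrightarrow>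
        (\<exists>a\<in>S. \<exists>b\<in>S. 0 < a \<and> a < b \<and> b - a \<le> (LEAST s. s \<in> S \<and> 0 < s))))"
proof -
  interpret urysohn M d S
    using assms by (simp add: urysohn_def urysohn_axioms_def urysohn_space_def)
  have pos: "0 < s" if "s \<in> S" "s \<noteq> 0" for s
    using S_nonneg[OF that(1)] that(2) by simp
  have limit: "distinguishing_number M d =o ctwo" if l: "0 < l" "l islimpt S" for l
  proof (cases "\<forall>\<epsilon>>0. \<exists>s\<in>S. l < s \<and> s < l + \<epsilon>")
    case True
    then show ?thesis using distinguishing_number_two_if_right_limit[OF l(1)] by blast
  next
    case False
    then obtain \<epsilon> where \<epsilon>: "0 < \<epsilon>" "\<And>s. s \<in> S \<Longrightarrow> l < s \<Longrightarrow> l + \<epsilon> \<le> s" by (meson not_less)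
    \<comment> \<open>No element of \<open>S\<close> lies strictly between \<open>l\<close> and
      \<open>l + \<epsilon>\<close>, so \<open>S\<close> must accumulate at \<open>l\<close> from
      below.\<close>
    have left: "\<exists>s\<in>S. l - \<delta> < s \<and> s < l" if \<delta>: "0 < \<delta>" for \<delta>
    proof -
      obtain s where "s \<in> S" "s \<noteq> l" "dist s l < min \<delta> \<epsilon>"
        using l(2) \<delta> \<epsilon>(1) unfolding islimpt_approachable by (metis min_less_iff_conj)
      moreover from this have "s < l"
        using \<epsilon>(2)[of s] by (cases s l rule: linorder_cases) (auto simp: dist_real_def)
      ultimately show ?thesis
        by (intro bexI[of _ s]) (auto simp: dist_real_def abs_less_iff)
    qed
    show ?thesis
    proof (rule distinguishing_number_two_if_close_pairs[of "S \<inter> {0<..<l}"])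
      show "S \<inter> {0<..<l} \<noteq> {}" using left[of l] l(1) by auto
      fix r \<delta> :: real assume r: "r \<in> S \<inter> {0<..<l}" and \<delta>: "\<delta> \<in> S" "0 < \<delta>"
      \<comment> \<open>Both \<open>r'\<close> and \<open>e\<close> are taken above \<open>r\<close>
        and within \<open>\<delta>\<close> below \<open>l\<close>, so their difference is less than
        \<open>\<delta>\<close>.\<close>
      obtain r' where r': "r' \<in> S" "l - min (l - r) \<delta> < r'" "r' < l"
        using left[of "min (l - r) \<delta>"] r \<delta>(2) by auto
      obtain e where e: "e \<in> S" "l - (l - r') < e" "e < l"
        using left[of "l - r'"] r'(3) by auto
      show "\<exists>r'\<in>S \<inter> {0<..<l}. \<exists>e\<in>S. r \<le> r' \<and> r' < e \<and> e \<le> r' + \<delta>"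
        using r r' e by (intro bexI[of _ r'] bexI[of _ e]) auto
    qed auto
  qed
  have zero_limit: "distinguishing_number M d =o ctwo"
    if close: "\<forall>N. \<forall>\<epsilon>>0. \<exists>a\<in>S. \<exists>b\<in>S. a < b \<and> a \<ge> N \<and> b - a < \<epsilon>"
  proof (rule distinguishing_number_two_if_close_pairs[of "S - {0}"])
    show "S - {0} \<noteq> {}" using assms(1) by (auto simp: universal_spectrum_def)
    fix r \<delta> assume r: "r \<in> S - {0}" and "\<delta> \<in> S" "0 < \<delta>"
    then obtain a b where "a \<in> S" "b \<in> S" "a < b" "r \<le> a" "b - a < \<delta>"
      using close by metis
    then show "\<exists>r'\<in>S - {0}. \<exists>e\<in>S. r \<le> r' \<and> r' < e \<and> e \<le> r' + \<delta>"
      using r pos[of r] by (intro bexI[of _ a] bexI[of _ b]) auto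
  qed auto
  have not_zero_limit: "infinite P"
    if "\<not> (\<exists>l>0. l islimpt S)" "0 islimpt S" "distinguishing_partition M d P"
      and far: "\<not> (\<forall>N. \<forall>\<epsilon>>0. \<exists>a\<in>S. \<exists>b\<in>S. a < b \<and> a \<ge> N \<and> b - a < \<epsilon>)" for P
  proof -
    obtain N \<epsilon> where "0 < \<epsilon>" "\<And>a b. a \<in> S \<Longrightarrow> b \<in> S \<Longrightarrow> N \<le> a \<Longrightarrow> a < b \<Longrightarrow> \<epsilon> \<le> b - a"
      using far by (meson not_less)
    then show ?thesis
      using infinite_distinguishing_partition_if_limit_zero[of \<epsilon> N P] that(1-3) by blast
  qed
  define s where "s = (LEAST s. s \<in> S \<and> 0 < s)"
  \<comment> \<open>Without limits, \<open>S\<close> has finitely many elements in a bounded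
    interval, so the minimum behind \<open>LEAST\<close> exists.\<close>
  have least: "s \<in> S" "0 < s" "\<And>x. x \<in> S \<Longrightarrow> 0 < x \<Longrightarrow> s \<le> x" if "\<not> (\<exists>l. l islimpt S)"
  proof -
    obtain s0 where s0: "s0 \<in> S" "0 < s0" using assms(1) by (auto simp: universal_spectrum_def)
    let ?A = "{0<..s0} \<inter> S"
    have "finite ({0..s0} \<inter> S)"
      by (rule finite_not_islimpt_in_compact) (use that in auto)
    then have fin: "finite ?A" by (rule finite_subset[rotated]) auto
    have "Min ?A \<in> ?A" using fin s0 by (intro Min_in) auto
    moreover have Min_le_all: "Min ?A \<le> x" if "x \<in> S" "0 < x" for x
    proof (cases "x \<le> s0")
      case False
      have "Min ?A \<le> s0" using fin s0 by (intro Min_le) auto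
      then show ?thesis using False by simp
    qed (use fin that in \<open>auto intro: Min_le\<close>)
    ultimately have "s = Min ?A"
      unfolding s_def by (intro Least_equality) auto
    with \<open>Min ?A \<in> ?A\<close> show "s \<in> S" "0 < s" by auto
    show "s \<le> x" if "x \<in> S" "0 < x" for x
      unfolding \<open>s = Min ?A\<close> using that by (rule Min_le_all)
  qed
  have no_limit: "distinguishing_number M d =o ctwo"
    if nl: "\<not> (\<exists>l. l islimpt S)" and ab: "\<exists>a\<in>S. \<exists>b\<in>S. 0 < a \<and> a < b \<and> b - a \<le> s"
  proof -
    obtain a b where "a \<in> S" "b \<in> S" "0 < a" "a < b" "b - a \<le> s" using ab by blast
    \<comment> \<open>The constant choice \<open>r' = a\<close>, \<open>e = b\<close> suffices,
      since every positive \<open>\<delta>\<close> in \<open>S\<close> is at least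
      \<open>s\<close>.\<close>
    then show ?thesis
      using least(3)[OF nl]
      by (intro distinguishing_number_two_if_close_pairs[of "{a}"]) force+
  qed
  have not_no_limit: "infinite P"
    if "\<not> (\<exists>l. l islimpt S)" "\<not> (\<exists>a\<in>S. \<exists>b\<in>S. 0 < a \<and> a < b \<and> b - a \<le> s)"
      "distinguishing_partition M d P" for P
    using infinite_distinguishing_partition_if_no_limit[OF least(1,2)[OF that(1)] _ that(3)] that(2)
    by (meson not_less)
  have limit_cases: "(\<exists>l>0. l islimpt S) \<or> 0 islimpt S \<or> \<not> (\<exists>l. l islimpt S)"
  proof -
    have "\<not> l islimpt S" if l: "l < 0" for l
    proof
      assume "l islimpt S"
      then obtain x where "x \<in> S" "dist x l < - l"
        using l unfolding islimpt_approachable by (metis neg_0_less_iff_less)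
      then show False using S_nonneg[of x] l by (auto simp: dist_real_def)
    qed
    then show ?thesis by (metis linorder_neqE_linordered_idom)
  qed
  note omega = distinguishing_number_omega
  define pos_limit where "pos_limit \<longleftrightarrow> (\<exists>l>0. l islimpt S)"
  define some_limit where "some_limit \<longleftrightarrow> (\<exists>l. l islimpt S)"
  define close_far where "close_far \<longleftrightarrow>
    (\<forall>N. \<forall>\<epsilon>>0. \<exists>a\<in>S. \<exists>b\<in>S. a < b \<and> a \<ge> N \<and> b - a < \<epsilon>)"
  define close_pair where "close_pair \<longleftrightarrow> (\<exists>a\<in>S. \<exists>b\<in>S. 0 < a \<and> a < b \<and> b - a \<le> s)"
  note folds = s_def[symmetric] pos_limit_def[symmetric] some_limit_def[symmetric]
    close_far_def[symmetric] close_pair_def[symmetric]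
  consider "\<exists>l>0. l islimpt S" | "\<not> (\<exists>l>0. l islimpt S)" "0 islimpt S" | "\<not> (\<exists>l. l islimpt S)"
    using limit_cases by argo
  then show ?thesis
  proof cases
    case 1
    then have "distinguishing_number M d =o ctwo" "\<exists>l. l islimpt S" using limit by auto
    with 1 show ?thesis unfolding folds by blast
  next
    case 2
    then have "\<exists>l. l islimpt S" by auto
    show ?thesis
    proof (cases "\<forall>N. \<forall>\<epsilon>>0. \<exists>a\<in>S. \<exists>b\<in>S. a < b \<and> a \<ge> N \<and> b - a < \<epsilon>")
      case True
      from zero_limit[OF this] True 2 \<open>\<exists>l. l islimpt S\<close> show ?thesis unfolding folds by blast
    next
      case False
      from omega[OF not_zero_limit[OF 2 _ False]] False 2 \<open>\<exists>l. l islimpt S\<close> show ?thesis unfolding folds by blast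
    qed
  next
    case 3
    then have no: "\<not> (\<exists>l>0. l islimpt S)" "\<not> 0 islimpt S" by auto
    show ?thesis
    proof (cases "\<exists>a\<in>S. \<exists>b\<in>S. 0 < a \<and> a < b \<and> b - a \<le> s")
      case True
      from no_limit[OF 3 True] True 3 no show ?thesis unfolding folds by blast
    next
      case False
      from omega[OF not_no_limit[OF 3 False]] False 3 no show ?thesis unfolding folds by blast
    qed
  qed
qed

end
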